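(* Let $(\mathcal H, \langle \cdot, \cdot \rangle_{\mathcal H})$ and $(\mathcal V, \langle \cdot, \cdot \rangle_{\mathcal V})$ be any real separable Hilbert spaces and let $\ell\ge1$ be an integer. Then, for all $F\in\mathcal S_{\mathcal V}$, $$\left\|D^\ell F\right\|_{L^1(\Omega;\mathcal H^{\otimes\ell}\otimes\mathcal V)}\le\eta\left(\left\|D^{\ell-1}F\right\|_{L^1(\Omega;\mathcal H^{\otimes(\ell-1)}\otimes\mathcal V)}+\left\|D^{\ell+1}F\right\|_{L^1(\Omega;\mathcal H^{\otimes(\ell+1)}\otimes\mathcal V)}\right),$$ where $D^0F:=F$, $\mathcal H^{\otimes0}\otimes\mathcal V:=\mathcal V$ and $$\eta:=\frac{\pi}{2}+18\sqrt{2e}.$$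
   Context: Setting. An isonormal Gaussian process over a real separable Hilbert space $\mathcal H$ is a centered Gaussian family $W=\{W(h):h\in\mathcal H\}$ of real random variables on a probability space $(\Omega,\mathcal F,\mathbb P)$ with $\mathbb E[W(h)W(g)]=\langle h,g\rangle_{\mathcal H}$ for all $h,g\in\mathcal H$. Throughout such a $W$ is fixed and $\mathcal F$ is the $\sigma$-field generated by $\{W(h):h\in\mathcal H\}$. $\mathcal S$ is the set of random variables $F=f(W(h_1),\dots,W(h_m))$ with $m\ge1$, $h_1,\dots,h_m\in\mathcal H$ and $f\in C^\infty(\mathbb R^m)$ such that $f$ and all its partial derivatives have at most polynomial growth. For an integer $k\ge1$, the $k$-th Malliavin derivative of such $F$ is the $\mathcal H^{\otimes k}$-valued random variable $$D^kF:=\sum_{i_1,\dots,i_k=1}^m\frac{\partial^k f}{\partial x_{i_1}\cdots\partial x_{i_k}}(W(h_1),\dots,W(h_m))\,h_{i_1}\otimes\cdots\otimes h_{i_k}$$ (independent of the chosen representation). $\mathcal S_{\mathcal V}$ is the set of $\mathcal V$-valued random variables $F=\sum_{j=1}^J F_j v_j$ with $J\ge 1$, $F_j\in\mathcal S$, $v_j\in\mathcal V$; for such $F$, $D^kF:=\sum_{j=1}^J(D^kF_j)\otimes v_j$, which takes values in the Hilbert tensor product $\mathcal H^{\otimes k}\otimes\mathcal V$. For a real separable Hilbert space $\mathcal K$, $\|G\|_{L^1(\Omega;\mathcal K)}:=\mathbb E[\|G\|_{\mathcal K}]$. *)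

theory Defs
  imports "HOL-Probability.Probability"
begin

section \<open>Hilbert bases of separable inner product spaces\<close>

definition orthonormal_set :: "'a::real_inner set \<Rightarrow> bool" where
  "orthonormal_set B \<longleftrightarrow> (\<forall>x\<in>B. \<forall>y\<in>B. x \<bullet> y = (if x = y then 1 else 0))"

definition is_hilbert_basis :: "'a::real_inner set \<Rightarrow> bool" where
  "is_hilbert_basis B \<longleftrightarrow> orthonormal_set B \<and> closure (span B) = UNIV"

primrec gram_schmidt :: "(nat \<Rightarrow> 'a::real_inner) \<Rightarrow> nat \<Rightarrow> 'a set" where
  "gram_schmidt d 0 = {}"
| "gram_schmidt d (Suc n) =
     (let y = d n - (\<Sum>b\<in>gram_schmidt d n. (d n \<bullet> b) *\<^sub>R b)
      in if y = 0 then gram_schmidt d n else insert (y /\<^sub>R norm y) (gram_schmidt d n))"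

lemma inner_sum_orthonormal:
  assumes "orthonormal_set B" "finite A" "A \<subseteq> B" "b \<in> A"
  shows "(\<Sum>a\<in>A. c a *\<^sub>R a) \<bullet> b = c b"
proof -
  have "(\<Sum>a\<in>A. c a *\<^sub>R a) \<bullet> b = (\<Sum>a\<in>A. c a * (a \<bullet> b))"
    by (simp add: inner_sum_left)
  also have "\<dots> = (\<Sum>a\<in>A. if a = b then c a else 0)"
    by (rule sum.cong) (use assms in \<open>auto simp: orthonormal_set_def subset_iff\<close>)
  also have "\<dots> = c b"
    using assms by simp
  finally show ?thesis .
qed

lemma finite_gram_schmidt: "finite (gram_schmidt d n)"
  by (induction n) (auto simp: Let_def)

lemma orthonormal_gram_schmidt: "orthonormal_set (gram_schmidt d n)"
proof (induction n)
  case 0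
  then show ?case by (simp add: orthonormal_set_def)
next
  case (Suc n)
  define E where "E = gram_schmidt d n"
  define y where "y = d n - (\<Sum>b\<in>E. (d n \<bullet> b) *\<^sub>R b)"
  have E: "orthonormal_set E" "finite E" using Suc finite_gram_schmidt by (auto simp: E_def)
  have y: "y \<bullet> b = 0" if "b \<in> E" for b
    using inner_sum_orthonormal[OF E(1,2) order_refl that] by (simp add: y_def inner_diff_left)
  show ?case
  proof (cases "y = 0")
    case True
    then show ?thesis using Suc by (simp add: y_def E_def)
  next
    case False
    have u: "(y /\<^sub>R norm y) \<bullet> (y /\<^sub>R norm y) = 1"
      using False by (simp add: dot_square_norm power2_eq_square)
    have "gram_schmidt d (Suc n) = insert (y /\<^sub>R norm y) E"
      using False by (simp add: y_def E_def Let_def)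
    moreover have "y /\<^sub>R norm y \<notin> E"
      using u y by fastforce
    ultimately show ?thesis
      using E(1) u y by (auto simp: orthonormal_set_def inner_commute)
  qed
qed

lemma gram_schmidt_mono:
  assumes "m \<le> n"
  shows "gram_schmidt d m \<subseteq> gram_schmidt d n"
proof (rule lift_Suc_mono_le[of "gram_schmidt d", OF _ assms])
  fix n
  show "gram_schmidt d n \<subseteq> gram_schmidt d (Suc n)"
    unfolding gram_schmidt.simps Let_def by (simp add: subset_insertI)
qed

lemma gram_schmidt_span: "d n \<in> span (gram_schmidt d (Suc n))"
proof -
  define E where "E = gram_schmidt d n"
  define s where "s = (\<Sum>b\<in>E. (d n \<bullet> b) *\<^sub>R b)"
  define E' where "E' = gram_schmidt d (Suc n)"
  have "E \<subseteq> E'" using gram_schmidt_mono[of n "Suc n" d] unfolding E_def E'_def by simp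
  then have s: "s \<in> span E'"
    unfolding s_def by (intro span_sum span_scale span_base) auto
  have "d n - s \<in> span E'"
  proof (cases "d n - s = 0")
    case False
    then have "(d n - s) /\<^sub>R norm (d n - s) \<in> E'"
      by (simp add: E'_def E_def s_def Let_def)
    then have "norm (d n - s) *\<^sub>R ((d n - s) /\<^sub>R norm (d n - s)) \<in> span E'"
      by (intro span_scale span_base)
    then show ?thesis using False by simp
  qed (simp add: span_zero)
  from span_add[OF this s] show ?thesis by (simp add: E'_def)
qed

lemma ex_hilbert_basis: "\<exists>B :: 'a::{real_inner,second_countable_topology} set. is_hilbert_basis B"
proof -
  obtain D :: "'a set" where D: "countable D" "\<And>X. open X \<Longrightarrow> X \<noteq> {} \<Longrightarrow> \<exists>d\<in>D. d \<in> X"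
    by (rule countable_dense_setE) blast
  define d where "d = from_nat_into D"
  have "D \<noteq> {}" using D(2)[of UNIV] by auto
  then have d: "range d = D" using D(1) by (simp add: d_def range_from_nat_into)
  define B where "B = (\<Union>n. gram_schmidt d n)"
  have "orthonormal_set B"
    unfolding orthonormal_set_def
  proof (intro ballI)
    fix x y assume "x \<in> B" "y \<in> B"
    then obtain m n where "x \<in> gram_schmidt d m" "y \<in> gram_schmidt d n" by (auto simp: B_def)
    then have "x \<in> gram_schmidt d (max m n)" "y \<in> gram_schmidt d (max m n)"
      using gram_schmidt_mono[of m "max m n" d] gram_schmidt_mono[of n "max m n" d] by auto
    then show "x \<bullet> y = (if x = y then 1 else 0)"
      using orthonormal_gram_schmidt[of d "max m n"] by (simp add: orthonormal_set_def)
  qed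
  moreover have "D \<subseteq> span B"
  proof -
    have "d n \<in> span B" for n
      using gram_schmidt_span[of d n] span_mono[of "gram_schmidt d (Suc n)" B]
      unfolding B_def by blast
    then show ?thesis using d by auto
  qed
  then have "closure (span B) = UNIV"
    using D(2) unfolding closure_def islimpt_def by fastforce
  ultimately show ?thesis by (auto simp: is_hilbert_basis_def)
qed

definition hilbert_basis :: "'a::{real_inner,second_countable_topology} set" where
  "hilbert_basis = (SOME B. is_hilbert_basis B)"

lemma is_hilbert_basis_hilbert_basis: "is_hilbert_basis hilbert_basis"
  unfolding hilbert_basis_def by (rule someI_ex) (rule ex_hilbert_basis)

lemma orthonormal_hilbert_basis: "orthonormal_set hilbert_basis"
  by (rule is_hilbert_basis_hilbert_basis[unfolded is_hilbert_basis_def, THEN conjunct1])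

lemma countable_hilbert_basis: "countable (hilbert_basis :: 'a::{real_inner,second_countable_topology} set)"
proof -
  let ?B = "hilbert_basis :: 'a set"
  obtain D :: "'a set" where D: "countable D" "\<And>X. open X \<Longrightarrow> X \<noteq> {} \<Longrightarrow> \<exists>d\<in>D. d \<in> X"
    by (rule countable_dense_setE) blast
  have "\<forall>b. \<exists>d\<in>D. dist b d < 1/2"
    using D(2)[of "ball _ (1/2)"] by force
  then obtain g where g: "\<And>b. g b \<in> D" "\<And>b. dist b (g b) < 1/2" by metis
  have "inj_on g ?B"
  proof (rule inj_onI, rule ccontr)
    fix a b assume ab: "a \<in> ?B" "b \<in> ?B" "g a = g b" "a \<noteq> b"
    have "dist a b < 1"
      using g(2)[of a] g(2)[of b] ab(3) dist_triangle2[of a b "g a"] by simp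
    moreover have "(dist a b)\<^sup>2 = 2"
      using ab orthonormal_hilbert_basis[where 'a = 'a]
      by (simp add: orthonormal_set_def dist_norm power2_norm_eq_inner inner_diff inner_commute)
    ultimately show False
      using power_mono[of "dist a b" 1 2] by simp
  qed
  moreover have "countable (g ` ?B)" using g(1) D(1) by (meson countable_subset image_subsetI)
  ultimately show ?thesis using countable_image_inj_on by blast
qed

lemma hilbert_basis_expansion:
  fixes x :: "'a::{real_inner,second_countable_topology}"
  shows "((\<lambda>b. (x \<bullet> b) *\<^sub>R b) has_sum x) hilbert_basis"
proof -
  let ?B = "hilbert_basis :: 'a set"
  let ?P = "\<lambda>A. \<Sum>b\<in>A. (x \<bullet> b) *\<^sub>R b"
  have best: "norm (x - ?P A) \<le> norm (x - z)" if A: "finite A" "A \<subseteq> ?B" "z \<in> span A" for A z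
  proof -
    have z: "?P A - z \<in> span A"
      using A(3) by (intro span_diff span_sum span_scale) (auto intro: span_base)
    have perp: "(x - ?P A) \<bullet> b = 0" if "b \<in> A" for b
      using inner_sum_orthonormal[OF orthonormal_hilbert_basis A(1,2) that, of "\<lambda>b. x \<bullet> b"]
      by (simp add: inner_diff_left)
    have "(x - ?P A) \<bullet> w = 0" if "w \<in> span A" for w
      using that
      by (induction w rule: span_induct_alt) (auto simp: inner_add_right perp)
    then have "(norm ((x - ?P A) + (?P A - z)))\<^sup>2 = (norm (x - ?P A))\<^sup>2 + (norm (?P A - z))\<^sup>2"
      using z by (simp only: norm_add_Pythagorean orthogonal_def)
    then have "(norm (x - z))\<^sup>2 \<ge> (norm (x - ?P A))\<^sup>2" by simp
    then show ?thesis by (rule power2_le_imp_le) simp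
  qed
  show ?thesis
    unfolding has_sum_def
  proof (rule tendstoI)
    fix e :: real assume "e > 0"
    have "x \<in> closure (span ?B)"
      using is_hilbert_basis_hilbert_basis[where 'a = 'a] by (simp add: is_hilbert_basis_def)
    then obtain z where z: "z \<in> span ?B" "dist z x < e" using \<open>e > 0\<close> by (meson closure_approachable)
    then obtain A where A: "finite A" "A \<subseteq> ?B" "z \<in> span A"
      by (smt (verit) mem_Collect_eq span_explicit span_base span_scale span_sum)
    have "dist (?P A') x < e" if "finite A'" "A \<subseteq> A'" "A' \<subseteq> ?B" for A'
      using best[of A' z] that A span_mono[of A A'] z(2) by (auto simp: dist_norm norm_minus_commute)
    then show "\<forall>\<^sub>F A in finite_subsets_at_top ?B. dist (?P A) x < e"
      using A unfolding eventually_finite_subsets_at_top by blast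
  qed
qed

lemma parseval:
  fixes x y :: "'a::{real_inner,second_countable_topology}"
  shows "((\<lambda>b. (x \<bullet> b) * (y \<bullet> b)) has_sum (x \<bullet> y)) hilbert_basis"
  using has_sum_bounded_linear[OF bounded_linear_inner_left hilbert_basis_expansion[of x], of y]
  by (simp add: o_def inner_commute)

section \<open>Hilbert tensor products\<close>

definition square_summable :: "('i \<Rightarrow> 'v::real_inner) \<Rightarrow> bool" where
  "square_summable f \<longleftrightarrow> (\<lambda>i. (norm (f i))\<^sup>2) summable_on UNIV"

lemma square_summable_zero: "square_summable (\<lambda>i. 0)"
  by (simp add: square_summable_def)

lemma square_summable_scaleR: "square_summable f \<Longrightarrow> square_summable (\<lambda>i. c *\<^sub>R f i)"
  by (simp add: square_summable_def power_mult_distrib summable_on_cmult_right)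

lemma square_summable_add:
  assumes "square_summable f" "square_summable g"
  shows "square_summable (\<lambda>i. f i + g i)"
proof -
  have "(\<lambda>i. 2 * (norm (f i))\<^sup>2 + 2 * (norm (g i))\<^sup>2) summable_on UNIV"
    using assms by (intro summable_on_add summable_on_cmult_right) (auto simp: square_summable_def)
  then show ?thesis
    unfolding square_summable_def
  proof (rule summable_on_comparison_test)
    fix i
    have "(norm (f i + g i))\<^sup>2 \<le> (norm (f i) + norm (g i))\<^sup>2"
      by (intro power_mono norm_triangle_ineq) simp
    also have "\<dots> \<le> 2 * (norm (f i))\<^sup>2 + 2 * (norm (g i))\<^sup>2"
      using sum_squares_bound[of "norm (f i)" "norm (g i)"] by (simp add: power2_sum)
    finally show "(norm (f i + g i))\<^sup>2 \<le> 2 * (norm (f i))\<^sup>2 + 2 * (norm (g i))\<^sup>2" .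
  qed simp
qed

lemma square_summable_inner:
  assumes "square_summable f" "square_summable g"
  shows "(\<lambda>i. f i \<bullet> g i) summable_on UNIV"
proof -
  have "(\<lambda>i. norm (norm (f i) * norm (g i))) summable_on UNIV"
    by (rule Infinite_Sum.abs_summable_product)
      (use assms in \<open>simp_all add: square_summable_def power2_eq_square abs_mult\<close>)
  then have "(\<lambda>i. norm (f i \<bullet> g i)) summable_on UNIV"
    by (rule Infinite_Sum.abs_summable_on_comparison_test) (simp add: Cauchy_Schwarz_ineq2)
  then show ?thesis by (rule Infinite_Sum.abs_summable_summable)
qed

text \<open>The order $k$ of the tensors has to vary inside one type, so \<open>('h, 'v) htensor\<close> is the Hilbert
  sum $\bigoplus_{k \ge 0} \mathcal H^{\otimes k} \otimes \mathcal V$. An element is given by its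
  $\ell^2$ family of coordinates in $\mathcal V$ with respect to the tensors
  $b_1 \otimes \dots \otimes b_k$ of members of a fixed Hilbert basis of $\mathcal H$.
  The summand $\mathcal H^{\otimes k} \otimes \mathcal V$ is \<open>htensor_degree k\<close> below. The theorems
  \<open>inner_pure_tensor\<close>, \<open>inner_tensor_vec\<close> and \<open>closure_span_tensors\<close> characterise it
  as a Hilbert tensor product, up to isometric isomorphism and independently of the basis.\<close>

typedef (overloaded) ('h::"{real_inner,second_countable_topology}", 'v::real_inner) htensor =
  "{T :: 'h list \<Rightarrow> 'v. (\<forall>bs. bs \<notin> lists hilbert_basis \<longrightarrow> T bs = 0) \<and> square_summable T}"
  morphisms coord Abs_htensor
  by (rule exI[of _ "\<lambda>_. 0"]) (simp add: square_summable_zero)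

lemma htensor_eqI: "(\<And>bs. coord S bs = coord T bs) \<Longrightarrow> S = T"
  by (simp add: coord_inject[symmetric] fun_eq_iff)

lemma coord_outside: "bs \<notin> lists hilbert_basis \<Longrightarrow> coord T bs = 0"
  using coord[of T] by blast

lemma square_summable_coord: "square_summable (coord T)"
  using coord[of T] by blast

lemma coord_Abs_htensor:
  assumes "\<And>bs. bs \<notin> lists hilbert_basis \<Longrightarrow> T bs = 0" "square_summable T"
  shows "coord (Abs_htensor T) = T"
  using assms by (intro Abs_htensor_inverse) blast

instantiation htensor :: ("{real_inner,second_countable_topology}", real_inner) real_inner
begin

definition "0 = Abs_htensor (\<lambda>_. 0)"
definition "S + T = Abs_htensor (\<lambda>bs. coord S bs + coord T bs)"
definition "c *\<^sub>R T = Abs_htensor (\<lambda>bs. c *\<^sub>R coord T bs)"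
definition "- T = (-1) *\<^sub>R (T :: ('a, 'b) htensor)"
definition "S - T = S + (-1) *\<^sub>R (T :: ('a, 'b) htensor)"
definition "S \<bullet> T = (\<Sum>\<^sub>\<infinity>bs. coord S bs \<bullet> coord T bs)"
definition "norm (T :: ('a, 'b) htensor) = sqrt (T \<bullet> T)"
definition "sgn (T :: ('a, 'b) htensor) = inverse (norm T) *\<^sub>R T"
definition "dist S (T :: ('a, 'b) htensor) = norm (S - T)"
definition "(uniformity :: (('a, 'b) htensor \<times> ('a, 'b) htensor) filter) =
  (INF e\<in>{0<..}. principal {(x, y). dist x y < e})"
definition "open (U :: ('a, 'b) htensor set) \<longleftrightarrow>
  (\<forall>x\<in>U. eventually (\<lambda>(x', y). x' = x \<longrightarrow> y \<in> U) uniformity)"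

lemma coord_zero [simp]: "coord 0 bs = 0"
  unfolding zero_htensor_def by (subst coord_Abs_htensor) (auto simp: square_summable_zero)

lemma coord_add [simp]: "coord (S + T) bs = coord S bs + coord T bs"
  unfolding plus_htensor_def
  by (subst coord_Abs_htensor)
    (auto simp: coord_outside intro: square_summable_add square_summable_coord)

lemma coord_scaleR [simp]: "coord (c *\<^sub>R T) bs = c *\<^sub>R coord T bs"
  unfolding scaleR_htensor_def
  by (subst coord_Abs_htensor)
    (auto simp: coord_outside intro: square_summable_scaleR square_summable_coord)

lemma coord_minus [simp]: "coord (- T) bs = - coord T bs"
  by (simp add: uminus_htensor_def)

lemma coord_diff [simp]: "coord (S - T) bs = coord S bs - coord T bs"
  by (simp add: minus_htensor_def)

lemma inner_htensor_has_sum: "((\<lambda>bs. coord S bs \<bullet> coord T bs) has_sum (S \<bullet> T)) UNIV"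
  unfolding inner_htensor_def
  by (intro has_sum_infsum square_summable_inner square_summable_coord)

instance
proof
  fix R S T :: "('a, 'b) htensor" and c c' :: real
  show "R + S + T = R + (S + T)" "R + S = S + R" "0 + R = R" "- R + R = 0" "R - S = R + - S"
    "c *\<^sub>R (R + S) = c *\<^sub>R R + c *\<^sub>R S" "(c + c') *\<^sub>R R = c *\<^sub>R R + c' *\<^sub>R R"
    "c *\<^sub>R c' *\<^sub>R R = (c * c') *\<^sub>R R" "1 *\<^sub>R R = R"
    by (auto intro!: htensor_eqI simp: algebra_simps)
  show "R \<bullet> S = S \<bullet> R"
    by (simp add: inner_htensor_def inner_commute)
  show "(R + S) \<bullet> T = R \<bullet> T + S \<bullet> T"
    using has_sum_add[OF inner_htensor_has_sum[of R T] inner_htensor_has_sum[of S T]]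
      inner_htensor_has_sum[of "R + S" T]
    by (auto simp: inner_add_left dest: has_sum_unique)
  show "(c *\<^sub>R R) \<bullet> T = c * (R \<bullet> T)"
    using has_sum_cmult_right[OF inner_htensor_has_sum[of R T], of c]
      inner_htensor_has_sum[of "c *\<^sub>R R" T]
    by (auto dest: has_sum_unique)
  show "0 \<le> R \<bullet> R"
    by (rule has_sum_nonneg[OF inner_htensor_has_sum]) simp
  show "R \<bullet> R = 0 \<longleftrightarrow> R = 0"
  proof
    assume "R \<bullet> R = 0"
    then have "coord R bs \<bullet> coord R bs = 0" for bs
      using nonneg_has_sum_le_0D[OF inner_htensor_has_sum[of R R], of bs] by simp
    then show "R = 0" by (intro htensor_eqI) simp
  qed (simp add: inner_htensor_def)
qed (simp_all add: norm_htensor_def sgn_htensor_def dist_htensor_def uniformity_htensor_def open_htensor_def)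

end

lemma norm_htensor_has_sum: "((\<lambda>bs. (norm (coord T bs))\<^sup>2) has_sum (norm T)\<^sup>2) UNIV"
  using inner_htensor_has_sum[of T T] by (simp add: power2_norm_eq_inner)

lemma sum_coord_le_norm: "finite A \<Longrightarrow> (\<Sum>bs\<in>A. (norm (coord T bs))\<^sup>2) \<le> (norm T)\<^sup>2"
  by (rule has_sum_mono2[OF has_sum_finite norm_htensor_has_sum]) auto

lemma norm_coord_le: "norm (coord T bs) \<le> norm T"
  using sum_coord_le_norm[of "{bs}" T] by (auto intro: power2_le_imp_le)

instance htensor :: ("{real_inner,second_countable_topology}", "{real_inner,complete_space}") complete_space
proof
  fix X :: "nat \<Rightarrow> ('a, 'b) htensor"
  assume X: "Cauchy X"
  have coord_Cauchy: "Cauchy (\<lambda>n. coord (X n) bs)" for bs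
  proof (rule metric_CauchyI)
    fix e :: real assume "e > 0"
    then obtain N where N: "\<And>m n. m \<ge> N \<Longrightarrow> n \<ge> N \<Longrightarrow> dist (X m) (X n) < e"
      using X unfolding Cauchy_def by blast
    have "dist (coord (X m) bs) (coord (X n) bs) < e" if "m \<ge> N" "n \<ge> N" for m n
      using N[OF that] norm_coord_le[of "X m - X n" bs] by (simp add: dist_norm)
    then show "\<exists>N. \<forall>m\<ge>N. \<forall>n\<ge>N. dist (coord (X m) bs) (coord (X n) bs) < e" by blast
  qed
  define L where "L bs = lim (\<lambda>n. coord (X n) bs)" for bs
  have L: "(\<lambda>n. coord (X n) bs) \<longlonglongrightarrow> L bs" for bs
    using Cauchy_convergent[OF coord_Cauchy[of bs]] by (simp add: L_def convergent_LIMSEQ_iff)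
  have L0: "L bs = 0" if "bs \<notin> lists hilbert_basis" for bs
    using L[of bs] by (simp add: coord_outside[OF that] LIMSEQ_const_iff)
  have est: "\<exists>N. \<forall>m\<ge>N. \<forall>A. finite A \<longrightarrow> (\<Sum>bs\<in>A. (norm (coord (X m) bs - L bs))\<^sup>2) \<le> e\<^sup>2"
    if e: "e > 0" for e
  proof -
    obtain N where N: "\<And>m n. m \<ge> N \<Longrightarrow> n \<ge> N \<Longrightarrow> dist (X m) (X n) < e"
      using X e unfolding Cauchy_def by blast
    have "(\<Sum>bs\<in>A. (norm (coord (X m) bs - L bs))\<^sup>2) \<le> e\<^sup>2" if "m \<ge> N" "finite A" for m A
    proof (rule LIMSEQ_le_const2)
      show "(\<lambda>n. \<Sum>bs\<in>A. (norm (coord (X m) bs - coord (X n) bs))\<^sup>2)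
              \<longlonglongrightarrow> (\<Sum>bs\<in>A. (norm (coord (X m) bs - L bs))\<^sup>2)"
        by (intro tendsto_intros L)
      have "(\<Sum>bs\<in>A. (norm (coord (X m) bs - coord (X n) bs))\<^sup>2) \<le> e\<^sup>2" if "n \<ge> N" for n
      proof -
        have "(\<Sum>bs\<in>A. (norm (coord (X m) bs - coord (X n) bs))\<^sup>2) \<le> (norm (X m - X n))\<^sup>2"
          using sum_coord_le_norm[OF \<open>finite A\<close>, of "X m - X n"] by simp
        also have "\<dots> \<le> e\<^sup>2"
          using N[OF \<open>m \<ge> N\<close> that] by (intro power_mono) (auto simp: dist_norm)
        finally show ?thesis .
      qed
      then show "\<exists>N. \<forall>n\<ge>N. (\<Sum>bs\<in>A. (norm (coord (X m) bs - coord (X n) bs))\<^sup>2) \<le> e\<^sup>2" by blast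
    qed
    then show ?thesis by blast
  qed
  have bound: "square_summable f" if "\<And>A. finite A \<Longrightarrow> (\<Sum>bs\<in>A. (norm (f bs))\<^sup>2) \<le> c"
    for f :: "'a list \<Rightarrow> 'b" and c
    unfolding square_summable_def
    by (rule nonneg_bdd_above_summable_on) (use that in \<open>auto intro!: bdd_aboveI2\<close>)
  obtain N where N: "\<And>A. finite A \<Longrightarrow> (\<Sum>bs\<in>A. (norm (coord (X N) bs - L bs))\<^sup>2) \<le> 1\<^sup>2"
    using est[of 1] by auto
  have "square_summable (\<lambda>bs. coord (X N) bs + (-1) *\<^sub>R (coord (X N) bs - L bs))"
    by (intro square_summable_add square_summable_scaleR square_summable_coord bound[OF N])
  then have "square_summable L" by simp
  define T where "T = Abs_htensor L"
  have T: "coord T = L"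
    unfolding T_def by (rule coord_Abs_htensor) (use L0 \<open>square_summable L\<close> in auto)
  have "X \<longlonglongrightarrow> T"
  proof (rule metric_LIMSEQ_I)
    fix e :: real assume "e > 0"
    then obtain N where N: "\<And>m A. m \<ge> N \<Longrightarrow> finite A \<Longrightarrow>
        (\<Sum>bs\<in>A. (norm (coord (X m) bs - L bs))\<^sup>2) \<le> (e / 2)\<^sup>2"
      using est[of "e / 2"] by auto
    have "dist (X m) T < e" if "m \<ge> N" for m
    proof -
      have "(norm (X m - T))\<^sup>2 \<le> (e / 2)\<^sup>2"
        by (rule has_sum_le_finite_sums[OF norm_htensor_has_sum]) (use N[OF that] T in auto)
      then have "norm (X m - T) \<le> e / 2"
        by (rule power2_le_imp_le) (use \<open>e > 0\<close> in simp)
      then show ?thesis using \<open>e > 0\<close> by (simp add: dist_norm)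
    qed
    then show "\<exists>N. \<forall>m\<ge>N. dist (X m) T < e" by blast
  qed
  then show "convergent X" by (auto simp: convergent_def)
qed

instance htensor :: ("{real_inner,second_countable_topology}", "{real_inner,complete_space}") banach ..

definition coord_single :: "'h::{real_inner,second_countable_topology} list \<Rightarrow> 'v::real_inner \<Rightarrow> ('h, 'v) htensor" where
  "coord_single bs v = Abs_htensor (\<lambda>cs. if cs = bs then v else 0)"

lemma coord_coord_single:
  assumes "bs \<in> lists hilbert_basis"
  shows "coord (coord_single bs v) cs = (if cs = bs then v else 0)"
proof -
  have "square_summable (\<lambda>cs. if cs = bs then v else 0)"
    unfolding square_summable_def
    by (rule summable_on_cong_neutral[THEN iffD1, OF _ _ _ summable_on_finite[of "{bs}"]]) auto
  then show ?thesis
    unfolding coord_single_def using assms by (subst coord_Abs_htensor) auto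
qed

lemma coord_sum: "coord (\<Sum>i\<in>I. T i) bs = (\<Sum>i\<in>I. coord (T i) bs)"
  by (induction I rule: infinite_finite_induct) auto

lemma htensor_expansion:
  "((\<lambda>bs. coord_single bs (coord T bs)) has_sum T) (lists hilbert_basis)"
  unfolding has_sum_def
proof (rule tendstoI)
  let ?S = "\<lambda>A. \<Sum>bs\<in>A. coord_single bs (coord T bs)"
  let ?L = "lists hilbert_basis"
  fix e :: real assume "e > 0"
  have c: "coord (?S A) cs = (if cs \<in> A then coord T cs else 0)" if "finite A" "A \<subseteq> ?L" for A cs
  proof -
    have "coord (?S A) cs = (\<Sum>bs\<in>A. if cs = bs then coord T bs else 0)"
      unfolding coord_sum by (rule sum.cong[OF refl], rule coord_coord_single, rule subsetD[OF that(2)])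
    then show ?thesis using that by simp
  qed
  have dist: "(dist (?S A) T)\<^sup>2 = (norm T)\<^sup>2 - (\<Sum>bs\<in>A. (norm (coord T bs))\<^sup>2)"
    if A: "finite A" "A \<subseteq> ?L" for A
  proof -
    have "((\<lambda>bs. (norm (coord T bs))\<^sup>2 + - (if bs \<in> A then (norm (coord T bs))\<^sup>2 else 0)) has_sum
        ((norm T)\<^sup>2 + - (\<Sum>bs\<in>A. (norm (coord T bs))\<^sup>2))) UNIV"
      by (intro has_sum_add norm_htensor_has_sum has_sum_uminus[THEN iffD2] has_sum_finite_neutralI) (use A in auto)
    moreover have "(\<lambda>bs. (norm (coord T bs))\<^sup>2 + - (if bs \<in> A then (norm (coord T bs))\<^sup>2 else 0)) =
        (\<lambda>bs. (norm (coord (?S A - T) bs))\<^sup>2)"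
      using c[OF A] by auto
    ultimately show ?thesis
      using norm_htensor_has_sum[of "?S A - T"] by (auto simp: dist_norm dest: has_sum_unique)
  qed
  have "((\<lambda>bs. (norm (coord T bs))\<^sup>2) has_sum (norm T)\<^sup>2) ?L"
    using norm_htensor_has_sum[of T]
    by (rule has_sum_cong_neutral[THEN iffD1, rotated -1]) (auto simp: coord_outside)
  then have "\<forall>\<^sub>F A in finite_subsets_at_top ?L. dist (\<Sum>bs\<in>A. (norm (coord T bs))\<^sup>2) ((norm T)\<^sup>2) < e\<^sup>2"
    unfolding has_sum_def by (rule tendstoD) (use \<open>e > 0\<close> in simp)
  moreover have "\<forall>\<^sub>F A in finite_subsets_at_top ?L. finite A \<and> A \<subseteq> ?L"
    by (rule eventually_finite_subsets_at_top_weakI) auto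
  ultimately show "\<forall>\<^sub>F A in finite_subsets_at_top ?L. dist (?S A) T < e"
  proof eventually_elim
    case (elim A)
    then have "(dist (?S A) T)\<^sup>2 < e\<^sup>2" using dist[of A] by (simp add: dist_real_def)
    then show ?case using \<open>e > 0\<close> by (simp add: power2_less_imp_less)
  qed
qed

lemma norm_coord_single: "bs \<in> lists hilbert_basis \<Longrightarrow> norm (coord_single bs v) = norm v"
proof -
  assume bs: "bs \<in> lists hilbert_basis"
  have "((\<lambda>cs. (norm (coord (coord_single bs v) cs))\<^sup>2) has_sum (norm v)\<^sup>2) UNIV"
    by (rule has_sum_finite_neutralI[of "{bs}"]) (auto simp: coord_coord_single[OF bs])
  then have "(norm (coord_single bs v))\<^sup>2 = (norm v)\<^sup>2"
    using norm_htensor_has_sum by (rule has_sum_unique[rotated])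
  then show ?thesis by simp
qed

lemma coord_single_diff:
  "bs \<in> lists hilbert_basis \<Longrightarrow> coord_single bs v - coord_single bs w = coord_single bs (v - w)"
  by (intro htensor_eqI) (simp add: coord_coord_single)

lemma closure_add_closed:
  fixes S :: "'a::real_normed_vector set"
  assumes "\<And>x y. x \<in> S \<Longrightarrow> y \<in> S \<Longrightarrow> x + y \<in> S" "x \<in> closure S" "y \<in> closure S"
  shows "x + y \<in> closure S"
proof -
  obtain f g where "\<And>n. f n \<in> S" "f \<longlonglongrightarrow> x" "\<And>n. g n \<in> S" "g \<longlonglongrightarrow> y"
    using assms(2,3) unfolding closure_sequential by blast
  then have "(\<forall>n. f n + g n \<in> S) \<and> (\<lambda>n. f n + g n) \<longlonglongrightarrow> x + y"
    using assms(1) by (auto intro: tendsto_add)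
  then show ?thesis unfolding closure_sequential by (intro exI[of _ "\<lambda>n. f n + g n"])
qed

lemma has_sum_in_closure:
  fixes S :: "'a::real_normed_vector set"
  assumes "\<And>x y. x \<in> S \<Longrightarrow> y \<in> S \<Longrightarrow> x + y \<in> S" "0 \<in> S"
    and "(f has_sum x) I" "\<And>i. i \<in> I \<Longrightarrow> f i \<in> closure S"
  shows "x \<in> closure S"
proof -
  have sum: "sum f A \<in> closure S" if "finite A" "A \<subseteq> I" for A
    using that
  proof (induction A rule: finite_induct)
    case empty
    then show ?case using assms(2) closure_subset[of S] by auto
  next
    case (insert a A)
    then show ?case using assms(4)[of a] by (auto intro!: closure_add_closed[OF assms(1)])
  qed
  have "\<forall>\<^sub>F A in finite_subsets_at_top I. sum f A \<in> closure S"
    by (rule eventually_finite_subsets_at_top_weakI) (use sum in auto)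
  then show ?thesis
    using Lim_in_closed_set[OF closed_closure _ finite_subsets_at_top_neq_bot, of "sum f" S I x] assms(3)
    by (simp add: has_sum_def)
qed

lemma countable_dense_imp_subbasis:
  fixes D :: "'a::metric_space set"
  assumes "countable D" "closure D = UNIV"
  shows "\<exists>B :: 'a set set. countable B \<and> open = generate_topology B"
proof -
  define B where "B = (\<lambda>(d, n). ball d (1 / real (Suc n))) ` (D \<times> UNIV)"
  have "topological_basis B"
  proof (rule topological_basisI)
    fix U :: "'a set" and x assume "open U" "x \<in> U"
    then obtain e where e: "e > 0" "ball x e \<subseteq> U" by (meson open_contains_ball)
    obtain n where n: "1 / real (Suc n) < e / 2" using nat_approx_posE[of "e / 2"] e by auto
    obtain d where d: "d \<in> D" "dist d x < 1 / real (Suc n)"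
      using assms(2) closure_approachable[of x D] by (metis UNIV_I of_nat_0_less_iff zero_less_Suc zero_less_divide_1_iff)
    have "ball d (1 / real (Suc n)) \<subseteq> U"
    proof
      fix y assume "y \<in> ball d (1 / real (Suc n))"
      then have "dist x y < e" using dist_triangle[of x y d] d(2) n by (simp add: dist_commute)
      then show "y \<in> U" using e(2) by auto
    qed
    moreover have "x \<in> ball d (1 / real (Suc n))" using d(2) by simp
    ultimately show "\<exists>V\<in>B. x \<in> V \<and> V \<subseteq> U" using d(1) unfolding B_def by blast
  qed (auto simp: B_def)
  moreover have "countable B" using assms(1) by (simp add: B_def)
  ultimately show ?thesis using topological_basis_imp_subbasis by blast
qed

instance htensor :: ("{real_inner,second_countable_topology}", "{real_inner,second_countable_topology}")
  second_countable_topology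
proof
  let ?L = "lists (hilbert_basis :: 'a set)"
  obtain D :: "'b set" where D: "countable D" "\<And>X. open X \<Longrightarrow> X \<noteq> {} \<Longrightarrow> \<exists>d\<in>D. d \<in> X"
    by (rule countable_dense_setE) blast
  define S :: "('a, 'b) htensor set" where
    "S = (\<lambda>xs. \<Sum>(bs, v)\<leftarrow>xs. coord_single bs v) ` lists (?L \<times> D)"
  have add: "x + y \<in> S" if "x \<in> S" "y \<in> S" for x y
  proof -
    obtain xs where xs: "x = (\<Sum>(bs, v)\<leftarrow>xs. coord_single bs v)" "xs \<in> lists (?L \<times> D)"
      using \<open>x \<in> S\<close> unfolding S_def by (rule imageE)
    obtain ys where ys: "y = (\<Sum>(bs, v)\<leftarrow>ys. coord_single bs v)" "ys \<in> lists (?L \<times> D)"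
      using \<open>y \<in> S\<close> unfolding S_def by (rule imageE)
    show ?thesis unfolding S_def by (rule image_eqI[of _ _ "xs @ ys"]) (use xs ys in auto)
  qed
  have zero: "0 \<in> S" unfolding S_def by (rule image_eqI[of _ _ "[]"]) auto
  have single: "coord_single bs v \<in> closure S" if bs: "bs \<in> ?L" for bs and v :: 'b
    unfolding closure_approachable
  proof (intro allI impI)
    fix e :: real assume "e > 0"
    then obtain d where d: "d \<in> D" "dist v d < e" using D(2)[of "ball v e"] by auto
    have "coord_single bs d \<in> S"
      unfolding S_def by (rule image_eqI[of _ _ "[(bs, d)]"]) (use bs d in auto)
    moreover have "dist (coord_single bs d) (coord_single bs v) < e"
      using d(2) bs by (simp add: dist_norm coord_single_diff norm_coord_single norm_minus_commute)
    ultimately show "\<exists>y\<in>S. dist y (coord_single bs v) < e" by blast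
  qed
  have "countable S"
    unfolding S_def by (intro countable_image countable_lists countable_SIGMA D(1) countable_hilbert_basis)
  moreover have "closure S = UNIV"
    using has_sum_in_closure[OF add zero htensor_expansion] single by blast
  ultimately show "\<exists>B :: ('a, 'b) htensor set set. countable B \<and> open = generate_topology B"
    by (rule countable_dense_imp_subbasis)
qed

instance htensor :: ("{real_inner,second_countable_topology}", "{real_inner,polish_space}") polish_space ..

text \<open>\<open>pure_tensor [h\<^sub>1, \<dots>, h\<^sub>k]\<close> is $h_1 \otimes \dots \otimes h_k$ and \<open>T \<otimes>\<^sub>V v\<close> is $T \otimes v$.\<close>

definition pure_tensor :: "'h::{real_inner,second_countable_topology} list \<Rightarrow> ('h, real) htensor" where
  "pure_tensor hs = Abs_htensor (\<lambda>bs. if bs \<in> lists hilbert_basis \<and> length bs = length hs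
     then \<Prod>i<length hs. hs ! i \<bullet> bs ! i else 0)"

definition tensor_vec ::
  "('h::{real_inner,second_countable_topology}, real) htensor \<Rightarrow> 'v::real_inner \<Rightarrow> ('h, 'v) htensor"
  (infixr "\<otimes>\<^sub>V" 75) where
  "T \<otimes>\<^sub>V v = Abs_htensor (\<lambda>bs. coord T bs *\<^sub>R v)"

definition htensor_degree :: "nat \<Rightarrow> ('h::{real_inner,second_countable_topology}, 'v::real_inner) htensor set" where
  "htensor_degree k = {T. \<forall>bs. length bs \<noteq> k \<longrightarrow> coord T bs = 0}"

lemma prod_inner_has_sum:
  fixes hs gs :: "'h::{real_inner,second_countable_topology} list"
  assumes "length hs = length gs"
  shows "((\<lambda>bs. (\<Prod>i<length hs. hs ! i \<bullet> bs ! i) * (\<Prod>i<length hs. gs ! i \<bullet> bs ! i)) has_sum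
      (\<Prod>i<length hs. hs ! i \<bullet> gs ! i)) {bs \<in> lists hilbert_basis. length bs = length hs}"
  using assms
proof (induction hs gs rule: list_induct2)
  case Nil
  have "{bs \<in> lists (hilbert_basis :: 'h set). length bs = length ([] :: 'h list)} = {[]}" by auto
  then show ?case using has_sum_finite[of "{[] :: 'h list}" "\<lambda>_. 1 :: real"] by simp
next
  case (Cons h hs g gs)
  let ?B = "hilbert_basis :: 'h set"
  let ?L = "\<lambda>n. {bs \<in> lists ?B. length bs = n}"
  let ?n = "length hs"
  define p where "p bs = (\<Prod>i<?n. hs ! i \<bullet> bs ! i) * (\<Prod>i<?n. gs ! i \<bullet> bs ! i)" for bs
  define q where "q = (\<lambda>(b, bs). ((h \<bullet> b) * (g \<bullet> b)) * p bs)"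
  have IH: "(p has_sum (\<Prod>i<?n. hs ! i \<bullet> gs ! i)) (?L ?n)"
    using Cons.IH by (simp add: p_def[abs_def])
  have abs_p: "(\<lambda>bs. \<bar>p bs\<bar>) summable_on ?L ?n"
    using IH summable_on_iff_abs_summable_on_real[of p] by (auto simp: summable_on_def)
  have abs_hg: "(\<lambda>b. \<bar>(h \<bullet> b) * (g \<bullet> b)\<bar>) summable_on ?B"
    using parseval[of h g] summable_on_iff_abs_summable_on_real[of "\<lambda>b. (h \<bullet> b) * (g \<bullet> b)" ?B]
    by (auto simp: summable_on_def)
  have "(\<lambda>x. \<bar>q x\<bar>) summable_on (?B \<times> ?L ?n)"
  proof (rule summable_on_SigmaI)
    fix b
    show "((\<lambda>bs. \<bar>q (b, bs)\<bar>) has_sum (\<bar>(h \<bullet> b) * (g \<bullet> b)\<bar> * (\<Sum>\<^sub>\<infinity>bs\<in>?L ?n. \<bar>p bs\<bar>))) (?L ?n)"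
      using has_sum_cmult_right[OF has_sum_infsum[OF abs_p], of "\<bar>(h \<bullet> b) * (g \<bullet> b)\<bar>"]
      by (simp add: q_def abs_mult)
  next
    show "(\<lambda>b. \<bar>(h \<bullet> b) * (g \<bullet> b)\<bar> * (\<Sum>\<^sub>\<infinity>bs\<in>?L ?n. \<bar>p bs\<bar>)) summable_on ?B"
      by (rule summable_on_cmult_left[OF abs_hg])
  qed simp
  then have q: "q summable_on (?B \<times> ?L ?n)"
    using summable_on_iff_abs_summable_on_real[of q] by simp
  have "(q has_sum ((h \<bullet> g) * (\<Prod>i<?n. hs ! i \<bullet> gs ! i))) (?B \<times> ?L ?n)"
  proof (rule has_sum_SigmaI[OF _ _ q])
    fix b
    show "((\<lambda>bs. q (b, bs)) has_sum (((h \<bullet> b) * (g \<bullet> b)) * (\<Prod>i<?n. hs ! i \<bullet> gs ! i))) (?L ?n)"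
      unfolding q_def prod.case by (rule has_sum_cmult_right[OF IH])
  next
    show "((\<lambda>b. ((h \<bullet> b) * (g \<bullet> b)) * (\<Prod>i<?n. hs ! i \<bullet> gs ! i)) has_sum
        ((h \<bullet> g) * (\<Prod>i<?n. hs ! i \<bullet> gs ! i))) ?B"
      by (rule has_sum_cmult_left[OF parseval])
  qed
  moreover have "bij_betw (\<lambda>(b, bs). b # bs) (?B \<times> ?L ?n) (?L (Suc ?n))"
    unfolding bij_betw_def
  proof
    show "(\<lambda>(b, bs). b # bs) ` (?B \<times> ?L ?n) = ?L (Suc ?n)"
      by (auto simp: length_Suc_conv image_iff)
  qed (auto simp: inj_on_def)
  ultimately show ?case
    using has_sum_reindex_bij_betw[of "\<lambda>(b, bs). b # bs" "?B \<times> ?L ?n" "?L (Suc ?n)"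
       "\<lambda>bs. (\<Prod>i<Suc ?n. (h # hs) ! i \<bullet> bs ! i) * (\<Prod>i<Suc ?n. (g # gs) ! i \<bullet> bs ! i)"]
    by (simp add: prod.lessThan_Suc_shift q_def p_def case_prod_unfold mult_ac del: prod.lessThan_Suc)
qed

lemma coord_pure_tensor:
  "coord (pure_tensor hs) bs = (if bs \<in> lists hilbert_basis \<and> length bs = length hs
     then \<Prod>i<length hs. hs ! i \<bullet> bs ! i else 0)"
proof -
  let ?f = "\<lambda>bs. if bs \<in> lists hilbert_basis \<and> length bs = length hs
     then \<Prod>i<length hs. hs ! i \<bullet> bs ! i else 0"
  have "(\<lambda>bs. (\<Prod>i<length hs. hs ! i \<bullet> bs ! i) * (\<Prod>i<length hs. hs ! i \<bullet> bs ! i))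
      summable_on {bs \<in> lists hilbert_basis. length bs = length hs}"
    using prod_inner_has_sum[of hs hs] by (auto simp: summable_on_def)
  then have "square_summable ?f"
    unfolding square_summable_def
    by (rule summable_on_cong_neutral[THEN iffD1, rotated -1]) (auto simp: power2_eq_square)
  then show ?thesis
    unfolding pure_tensor_def by (subst coord_Abs_htensor) auto
qed

lemma coord_tensor_vec: "coord (T \<otimes>\<^sub>V v) bs = coord T bs *\<^sub>R v"
proof -
  have "square_summable (\<lambda>bs. coord T bs *\<^sub>R v)"
    using square_summable_coord[of T]
    by (simp add: square_summable_def power_mult_distrib summable_on_cmult_left)
  then show ?thesis
    unfolding tensor_vec_def by (subst coord_Abs_htensor) (auto simp: coord_outside)
qed

theorem inner_pure_tensor:
  "pure_tensor hs \<bullet> pure_tensor gs =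
     (if length hs = length gs then \<Prod>i<length hs. hs ! i \<bullet> gs ! i else 0)"
proof (cases "length hs = length gs")
  case True
  have "((\<lambda>bs. coord (pure_tensor hs) bs \<bullet> coord (pure_tensor gs) bs) has_sum
      (\<Prod>i<length hs. hs ! i \<bullet> gs ! i)) UNIV"
    using prod_inner_has_sum[OF True]
    by (rule has_sum_cong_neutral[THEN iffD1, rotated -1]) (use True in \<open>auto simp: coord_pure_tensor\<close>)
  then show ?thesis
    using True inner_htensor_has_sum[of "pure_tensor hs" "pure_tensor gs"] has_sum_unique by force
next
  case False
  then have *: "coord (pure_tensor hs) bs \<bullet> coord (pure_tensor gs) bs = 0" for bs
    by (auto simp: coord_pure_tensor)
  show ?thesis unfolding inner_htensor_def * using False by simp
qed

theorem inner_tensor_vec: "(S \<otimes>\<^sub>V v) \<bullet> (T \<otimes>\<^sub>V w) = (S \<bullet> T) * (v \<bullet> w)"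
proof -
  have "((\<lambda>bs. coord (S \<otimes>\<^sub>V v) bs \<bullet> coord (T \<otimes>\<^sub>V w) bs) has_sum (S \<bullet> T) * (v \<bullet> w)) UNIV"
    using has_sum_cmult_left[OF inner_htensor_has_sum[of S T], of "v \<bullet> w"]
    by (simp add: coord_tensor_vec mult_ac)
  then show ?thesis using inner_htensor_has_sum has_sum_unique by blast
qed

theorem bounded_bilinear_tensor_vec: "bounded_bilinear (\<otimes>\<^sub>V)"
proof
  show "\<exists>K. \<forall>(T :: ('a, real) htensor) (v :: 'b). norm (T \<otimes>\<^sub>V v) \<le> norm T * norm v * K"
    by (rule exI[of _ 1]) (simp add: norm_eq_sqrt_inner inner_tensor_vec real_sqrt_mult)
qed (auto intro!: htensor_eqI simp: coord_tensor_vec algebra_simps)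

theorem pure_tensor_multilinear:
  "linear (\<lambda>h. pure_tensor (hs @ h # gs))"
proof -
  define c where "c bs = (\<Prod>i\<in>{..<length hs + Suc (length gs)} - {length hs}. (hs @ 0 # gs) ! i \<bullet> bs ! i)"
    for bs :: "'a list"
  have *: "(\<Prod>i<length (hs @ h # gs). (hs @ h # gs) ! i \<bullet> bs ! i) = (h \<bullet> bs ! length hs) * c bs" for h bs
  proof -
    have "(hs @ h # gs) ! i = (hs @ 0 # gs) ! i" if "i \<noteq> length hs" for i
      using that by (simp add: nth_append nth_Cons')
    then show ?thesis
      unfolding c_def by (subst prod.remove[of _ "length hs"]) auto
  qed
  have **: "coord (pure_tensor (hs @ h # gs)) bs =
      (if bs \<in> lists hilbert_basis \<and> length bs = length hs + Suc (length gs)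
       then (h \<bullet> bs ! length hs) * c bs else 0)" for h bs
    unfolding coord_pure_tensor * by simp
  show ?thesis
    by (rule linearI; rule htensor_eqI) (simp_all add: ** inner_add_left distrib_right)
qed

theorem closure_span_tensors:
  "closure (span {pure_tensor hs \<otimes>\<^sub>V v | hs v. length hs = k}) =
     (htensor_degree k :: ('h::{real_inner,second_countable_topology}, 'v::real_inner) htensor set)"
    (is "closure (span ?G) = _")
proof
  have "bounded_linear (\<lambda>T :: ('h, 'v) htensor. coord T bs)" for bs
    by (rule bounded_linear_intro[of _ 1]) (auto simp: norm_coord_le)
  then have cont: "continuous_on UNIV (\<lambda>T :: ('h, 'v) htensor. coord T bs)" for bs
    using linear_continuous_on by blast
  have "htensor_degree k = (\<Inter>bs\<in>{bs. length bs \<noteq> k}. {T :: ('h, 'v) htensor. coord T bs = 0})"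
    by (auto simp: htensor_degree_def)
  moreover have "closed \<dots>"
    by (intro closed_INT ballI closed_Collect_eq cont continuous_on_const)
  ultimately have "closed (htensor_degree k :: ('h, 'v) htensor set)" by simp
  moreover have "span ?G \<subseteq> (htensor_degree k :: ('h, 'v) htensor set)"
    by (rule span_minimal)
      (auto simp: htensor_degree_def coord_tensor_vec coord_pure_tensor subspace_def)
  ultimately show "closure (span ?G) \<subseteq> htensor_degree k" by (intro closure_minimal)
next
  show "htensor_degree k \<subseteq> closure (span ?G)"
  proof
    fix T :: "('h, 'v) htensor" assume T: "T \<in> htensor_degree k"
    have "coord_single bs (coord T bs) \<in> closure (span ?G)" if bs: "bs \<in> lists hilbert_basis" for bs
    proof (cases "length bs = k")
      case True
      have "(\<Prod>i<length bs. bs ! i \<bullet> cs ! i) = (if cs = bs then 1 else 0)"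
        if cs: "cs \<in> lists hilbert_basis" "length cs = length bs" for cs
      proof -
        have "(\<Prod>i<length bs. bs ! i \<bullet> cs ! i) = (\<Prod>i<length bs. if bs ! i = cs ! i then 1 else (0::real))"
          using orthonormal_hilbert_basis[where 'a = 'h] cs bs
          by (intro prod.cong) (auto simp: orthonormal_set_def in_lists_conv_set)
        also have "\<dots> = (if cs = bs then 1 else 0)"
        proof (cases "cs = bs")
          case False
          then obtain i where "i < length bs" "bs ! i \<noteq> cs ! i"
            using cs(2) by (metis nth_equalityI)
          then show ?thesis using False by (auto intro!: prod_zero)
        qed simp
        finally show ?thesis .
      qed
      then have "coord_single bs (coord T bs) = pure_tensor bs \<otimes>\<^sub>V coord T bs"
        using bs by (intro htensor_eqI) (auto simp: coord_coord_single coord_tensor_vec coord_pure_tensor)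
      then have "coord_single bs (coord T bs) \<in> span ?G"
        using True by (auto intro!: span_base)
      then show ?thesis using closure_subset by blast
    next
      case False
      then have "coord_single bs (coord T bs) = 0"
        using T bs by (intro htensor_eqI) (auto simp: coord_coord_single htensor_degree_def)
      then show ?thesis using span_zero closure_subset by auto
    qed
    note single = this
    show "T \<in> closure (span ?G)"
      by (rule has_sum_in_closure[OF span_add span_zero htensor_expansion]) (simp_all only: single)
  qed
qed

section \<open>Isonormal Gaussian processes\<close>

text \<open>The first disjunct is the degenerate law \<open>N(0, 0)\<close>, which has no density.\<close>

definition centered_gaussian :: "'w measure \<Rightarrow> ('w \<Rightarrow> real) \<Rightarrow> bool" where
  "centered_gaussian M X \<longleftrightarrow> X \<in> borel_measurable M \<and>
     ((AE \<omega> in M. X \<omega> = 0) \<or> (\<exists>\<sigma>>0. distributed M lborel X (normal_density 0 \<sigma>)))"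

definition centered_gaussian_family :: "'w measure \<Rightarrow> ('i \<Rightarrow> 'w \<Rightarrow> real) \<Rightarrow> bool" where
  "centered_gaussian_family M W \<longleftrightarrow>
     (\<forall>A c. finite A \<longrightarrow> centered_gaussian M (\<lambda>\<omega>. \<Sum>i\<in>A. c i * W i \<omega>))"

definition isonormal_process :: "'w measure \<Rightarrow> ('h::real_inner \<Rightarrow> 'w \<Rightarrow> real) \<Rightarrow> bool" where
  "isonormal_process M W \<longleftrightarrow> prob_space M \<and> centered_gaussian_family M W \<and>
     (\<forall>h g. prob_space.expectation M (\<lambda>\<omega>. W h \<omega> * W g \<omega>) = h \<bullet> g)"

definition generated_sigma_field :: "'w measure \<Rightarrow> ('i \<Rightarrow> 'w \<Rightarrow> real) \<Rightarrow> bool" where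
  "generated_sigma_field M W \<longleftrightarrow>
     sets M = sigma_sets (space M) {W i -` A \<inter> space M | i A. A \<in> sets borel}"

section \<open>Smooth functions of finitely many variables\<close>

text \<open>A function on $\mathbb R^m$ is encoded as a function on \<open>nat \<Rightarrow> real\<close> that depends only on
  the coordinates below \<open>m\<close>; for such functions continuity in the product topology
  on \<open>nat \<Rightarrow> real\<close> is continuity on $\mathbb R^m$.\<close>

definition partial :: "nat \<Rightarrow> ((nat \<Rightarrow> real) \<Rightarrow> real) \<Rightarrow> (nat \<Rightarrow> real) \<Rightarrow> real" where
  "partial i f x = deriv (\<lambda>t. f (x(i := t))) (x i)"

definition partials :: "nat list \<Rightarrow> ((nat \<Rightarrow> real) \<Rightarrow> real) \<Rightarrow> (nat \<Rightarrow> real) \<Rightarrow> real" where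
  "partials is f = foldr partial is f"

definition smooth_fun :: "nat \<Rightarrow> ((nat \<Rightarrow> real) \<Rightarrow> real) \<Rightarrow> bool" where
  "smooth_fun m f \<longleftrightarrow>
     (\<forall>x y. (\<forall>i<m. x i = y i) \<longrightarrow> f x = f y) \<and>
     (\<forall>is\<in>lists {..<m}. continuous_on UNIV (partials is f) \<and>
        (\<forall>i<m. \<forall>x. (\<lambda>t. partials is f (x(i := t))) differentiable (at (x i))))"

definition polynomial_growth :: "nat \<Rightarrow> ((nat \<Rightarrow> real) \<Rightarrow> real) \<Rightarrow> bool" where
  "polynomial_growth m f \<longleftrightarrow> (\<exists>C N. \<forall>x. \<bar>f x\<bar> \<le> C * (1 + L2_set x {..<m}) ^ N)"

definition smooth_polynomial_growth :: "nat \<Rightarrow> ((nat \<Rightarrow> real) \<Rightarrow> real) \<Rightarrow> bool" where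
  "smooth_polynomial_growth m f \<longleftrightarrow>
     smooth_fun m f \<and> (\<forall>is\<in>lists {..<m}. polynomial_growth m (partials is f))"

section \<open>Smooth random variables and Malliavin derivatives\<close>

text \<open>Random variables are identified when they agree almost surely.\<close>

definition smooth_rep ::
  "'w measure \<Rightarrow> ('h \<Rightarrow> 'w \<Rightarrow> real) \<Rightarrow> ('w \<Rightarrow> real) \<Rightarrow>
   nat \<times> (nat \<Rightarrow> 'h) \<times> ((nat \<Rightarrow> real) \<Rightarrow> real) \<Rightarrow> bool" where
  "smooth_rep M W F = (\<lambda>(m, h, f). m \<ge> 1 \<and> smooth_polynomial_growth m f \<and>
     (AE \<omega> in M. F \<omega> = f (\<lambda>i. W (h i) \<omega>)))"

definition smooth_rv :: "'w measure \<Rightarrow> ('h \<Rightarrow> 'w \<Rightarrow> real) \<Rightarrow> ('w \<Rightarrow> real) set" where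
  "smooth_rv M W = {F \<in> borel_measurable M. \<exists>r. smooth_rep M W F r}"

text \<open>The Malliavin derivatives are computed from a chosen representation. Another choice changes
  them only on a null set.\<close>

definition malliavin ::
  "'w measure \<Rightarrow> ('h::{real_inner,second_countable_topology} \<Rightarrow> 'w \<Rightarrow> real) \<Rightarrow> nat \<Rightarrow>
   ('w \<Rightarrow> real) \<Rightarrow> 'w \<Rightarrow> ('h, real) htensor" where
  "malliavin M W k F = (case SOME r. smooth_rep M W F r of (m, h, f) \<Rightarrow>
     \<lambda>\<omega>. \<Sum>is | set is \<subseteq> {..<m} \<and> length is = k.
       partials is f (\<lambda>i. W (h i) \<omega>) *\<^sub>R pure_tensor (map h is))"

definition smooth_vec_rep ::
  "'w measure \<Rightarrow> ('h \<Rightarrow> 'w \<Rightarrow> real) \<Rightarrow> ('w \<Rightarrow> 'v::real_inner) \<Rightarrow>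
   nat \<times> (nat \<Rightarrow> 'w \<Rightarrow> real) \<times> (nat \<Rightarrow> 'v) \<Rightarrow> bool" where
  "smooth_vec_rep M W F = (\<lambda>(J, G, v). J \<ge> 1 \<and> (\<forall>j<J. G j \<in> smooth_rv M W) \<and>
     (AE \<omega> in M. F \<omega> = (\<Sum>j<J. G j \<omega> *\<^sub>R v j)))"

definition smooth_vec_rv ::
  "'w measure \<Rightarrow> ('h \<Rightarrow> 'w \<Rightarrow> real) \<Rightarrow> ('w \<Rightarrow> 'v::real_inner) set" where
  "smooth_vec_rv M W = {F \<in> borel_measurable M. \<exists>r. smooth_vec_rep M W F r}"

text \<open>For \<open>k = 0\<close> the derivative is \<open>F\<close> itself: \<open>v \<mapsto> pure_tensor [] \<otimes>\<^sub>V v\<close> is the isometric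
  identification of $\mathcal V$ with $\mathcal H^{\otimes 0} \otimes \mathcal V$.\<close>

definition malliavin_vec ::
  "'w measure \<Rightarrow> ('h::{real_inner,second_countable_topology} \<Rightarrow> 'w \<Rightarrow> real) \<Rightarrow> nat \<Rightarrow>
   ('w \<Rightarrow> 'v::real_inner) \<Rightarrow> 'w \<Rightarrow> ('h, 'v) htensor" where
  "malliavin_vec M W k F =
     (if k = 0 then \<lambda>\<omega>. pure_tensor [] \<otimes>\<^sub>V F \<omega>
      else case SOME r. smooth_vec_rep M W F r of (J, G, v) \<Rightarrow>
        \<lambda>\<omega>. \<Sum>j<J. malliavin M W k (G j) \<omega> \<otimes>\<^sub>V v j)"

lemma malliavin_vec_in_htensor_degree: "malliavin_vec M W k F \<omega> \<in> htensor_degree k"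
  by (auto simp: malliavin_vec_def malliavin_def htensor_degree_def coord_tensor_vec
      coord_pure_tensor coord_sum intro!: sum.neutral split: prod.splits)

lemma norm_malliavin_vec_0: "norm (malliavin_vec M W 0 F \<omega>) = norm (F \<omega>)"
  by (simp add: malliavin_vec_def norm_eq_sqrt_inner inner_tensor_vec inner_pure_tensor)

definition L1_norm :: "'w measure \<Rightarrow> ('w \<Rightarrow> 'k::real_normed_vector) \<Rightarrow> ennreal" where
  "L1_norm M G = (\<integral>\<^sup>+\<omega>. ennreal (norm (G \<omega>)) \<partial>M)"

end

theory Submission
  imports Defs
begin

text \<open>
  Let \<open>U = D\<^sup>l\<^sup>-\<^sup>1 F\<close>, regarded as a function of the Gaussian coordinates on which \<open>F\<close> depends,
  and write \<open>U'(x)[w]\<close> and \<open>U''(x)[z, y]\<close> for its directional derivatives. Let \<open>x, y, z, w\<close> be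
  independent copies of the coordinate vector. The norm of \<open>D\<^sup>l F\<close> at \<open>x\<close> is the Hilbert--Schmidt norm
  of \<open>U'(x)\<close>, and Khinchine's inequality (\<open>khinchine_vector\<close>) bounds it by \<open>sqrt (\<pi>/2)\<close> times the
  mean over \<open>w\<close> of \<open>\<parallel>U'(x)[w]\<parallel>\<close>. In the other direction, the mean over \<open>z, y\<close> of
  \<open>\<parallel>U''(x)[z, y]\<parallel>\<close> is at most the norm of \<open>D\<^sup>l\<^sup>+\<^sup>1 F\<close> at \<open>x\<close>, by Jensen's inequality
  (\<open>nn_integral_norm_vector_le\<close>).

  It remains to bound \<open>E \<parallel>U'(x)[w]\<parallel>\<close>. Put \<open>w\<^sub>s = cos s w + sin s y\<close>. For every \<open>s\<close>
  the pair of \<open>w\<^sub>s\<close> and its velocity \<open>w\<^sub>s'\<close> has the law of two independent copies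
  (\<open>rotation_invariant\<close>). On the path from \<open>w\<close> to \<open>- w\<close>, \<open>0 \<le> s \<le> \<pi>\<close>, the function
  \<open>s \<mapsto> U(w\<^sub>s) - U'(x)[w\<^sub>s]\<close> has the derivative \<open>(U'(w\<^sub>s) - U'(x))[w\<^sub>s']\<close>, and therefore
  \<open>2 E \<parallel>U'(x)[w]\<parallel> \<le> 2 E \<parallel>U\<parallel> + \<pi> E \<parallel>(U'(z) - U'(x))[y]\<parallel>\<close>. A quarter turn between the independent
  points \<open>x\<close> and \<open>z\<close> bounds the last mean by \<open>\<pi>/2\<close> times \<open>E \<parallel>U''(x)[z, y]\<parallel>\<close>
  (\<open>first_order_interpolation\<close>). Altogether
  \<open>E \<parallel>D\<^sup>l F\<parallel> \<le> sqrt (\<pi>/2) (E \<parallel>D\<^sup>l\<^sup>-\<^sup>1 F\<parallel> + \<pi>\<^sup>2/4 E \<parallel>D\<^sup>l\<^sup>+\<^sup>1 F\<parallel>)\<close>, and both constants lie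
  well below \<open>\<eta>\<close>. All these means are integrals of
  nonnegative functions, so Tonelli's theorem justifies every exchange of integrations.

  The coordinates are not orthonormalized: they are an arbitrary Gaussian family \<open>W (h i)\<close>, whose law
  may be degenerate, and the geometry of \<open>\<H>\<close> enters only through the covariances \<open>h i \<bullet> h j\<close>.
  Rotation invariance then rests on the fact that a joint law is determined by its
  characteristic function (\<open>joint_law_unique\<close>), which is derived from the one-dimensional case.
\<close>

section \<open>Joint laws and characteristic functions\<close>

text \<open>A bounded weight of positive mass turns the law of \<open>X\<close> into another probability law on the
  line, to which Levy's uniqueness theorem applies.\<close>

lemma weighted_law:
  fixes N :: "'a measure" and w X :: "'a \<Rightarrow> real"
  assumes "prob_space N"
    and w [measurable]: "w \<in> borel_measurable N" and bounds: "\<And>x. 0 \<le> w x" "\<And>x. w x \<le> B"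
    and X [measurable]: "X \<in> borel_measurable N"
    and c: "0 < c" and c_eq: "c = (\<integral>x. w x \<partial>N)"
  defines "\<mu> \<equiv> distr (density N (\<lambda>x. ennreal (w x / c))) borel X"
  shows "real_distribution \<mu>"
    and "char \<mu> t = (\<integral>x. complex_of_real (w x) * iexp (t * X x) \<partial>N) / complex_of_real c"
    and "A \<in> sets borel \<Longrightarrow> measure \<mu> A = (\<integral>x. w x * indicator A (X x) \<partial>N) / c"
proof -
  interpret N: prob_space N by fact
  have "B \<ge> 0" using bounds[of undefined] by simp
  then have int: "integrable N w"
    by (intro N.integrable_const_bound[of _ B]) (use bounds in auto)
  have "emeasure (density N (\<lambda>x. ennreal (w x / c))) (space N) = (\<integral>\<^sup>+x. ennreal (w x / c) \<partial>N)"
    by (subst emeasure_density) (auto intro!: nn_integral_cong)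
  also have "\<dots> = ennreal (\<integral>x. w x / c \<partial>N)"
    by (intro nn_integral_eq_integral integrable_divide int AE_I2) (use c bounds in auto)
  also have "(\<integral>x. w x / c \<partial>N) = 1" using c by (simp add: c_eq[symmetric])
  finally have D: "prob_space (density N (\<lambda>x. ennreal (w x / c)))"
    by (intro prob_spaceI) simp
  show rd: "real_distribution \<mu>"
    unfolding \<mu>_def real_distribution_def real_distribution_axioms_def
    by (auto intro!: prob_space.prob_space_distr[OF D])
  interpret \<mu>: real_distribution \<mu> by (rule rd)
  have "char \<mu> t = (\<integral>x. (w x / c) *\<^sub>R iexp (t * X x) \<partial>N)"
    unfolding char_def \<mu>_def
    by (subst integral_distr, simp, simp, subst integral_density) (use c bounds in auto)
  also have "\<dots> = (\<integral>x. complex_of_real (w x) * iexp (t * X x) / complex_of_real c \<partial>N)"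
    by (intro Bochner_Integration.integral_cong) (auto simp: scaleR_conv_of_real)
  finally show "char \<mu> t = (\<integral>x. complex_of_real (w x) * iexp (t * X x) \<partial>N) / complex_of_real c"
    by simp
  assume A [measurable]: "A \<in> sets borel"
  have "measure \<mu> A = (\<integral>x. indicator A x \<partial>\<mu>)" by simp
  also have "\<dots> = (\<integral>x. (w x / c) *\<^sub>R indicator A (X x) \<partial>N)"
    unfolding \<mu>_def
    by (subst integral_distr, simp, simp, subst integral_density) (use c bounds in auto)
  finally show "measure \<mu> A = (\<integral>x. w x * indicator A (X x) \<partial>N) / c" by simp
qed

lemma weighted_law_unique:
  fixes N :: "'a measure" and N' :: "'b measure"
  assumes "prob_space N" "prob_space N'"
    and w [measurable]: "w \<in> borel_measurable N" and bounds: "\<And>x. 0 \<le> w x" "\<And>x. w x \<le> B"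
    and w' [measurable]: "w' \<in> borel_measurable N'" and bounds': "\<And>x. 0 \<le> w' x" "\<And>x. w' x \<le> B"
    and X [measurable]: "X \<in> borel_measurable N" and X' [measurable]: "X' \<in> borel_measurable N'"
    and eq: "\<And>u. (\<integral>x. complex_of_real (w x) * iexp (u * X x) \<partial>N) =
                  (\<integral>x. complex_of_real (w' x) * iexp (u * X' x) \<partial>N')"
    and A [measurable]: "A \<in> sets borel"
  shows "(\<integral>x. w x * indicator A (X x) \<partial>N) = (\<integral>x. w' x * indicator A (X' x) \<partial>N')"
proof -
  interpret N: prob_space N by fact
  interpret N': prob_space N' by fact
  have "B \<ge> 0" using bounds[of undefined] by simp
  then have int: "integrable N w" "integrable N' w'"
    by (intro N.integrable_const_bound[of _ B] N'.integrable_const_bound[of _ B];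
        use bounds bounds' in auto)+
  have c: "(\<integral>x. w x \<partial>N) = (\<integral>x. w' x \<partial>N')" (is "?c = ?c'")
  proof -
    have "complex_of_real ?c = complex_of_real ?c'"
      using eq[of 0] by (simp add: integral_complex_of_real)
    then show ?thesis by (simp only: of_real_eq_iff)
  qed
  show ?thesis
  proof (cases "?c = 0")
    case True
    then have "AE x in N. w x = 0" "AE x in N'. w' x = 0"
      using integral_nonneg_eq_0_iff_AE[OF int(1)] integral_nonneg_eq_0_iff_AE[OF int(2)] bounds bounds' c
      by auto
    then have "(\<integral>x. w x * indicator A (X x) \<partial>N) = (\<integral>x. 0 \<partial>N)"
      "(\<integral>x. w' x * indicator A (X' x) \<partial>N') = (\<integral>x. 0 \<partial>N')"
      by (intro integral_cong_AE; auto)+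
    then show ?thesis by simp
  next
    case False
    moreover have "0 \<le> ?c" by (rule integral_nonneg_AE) (simp add: bounds)
    ultimately have pos: "0 < ?c" by simp
    note L = weighted_law[OF assms(1) w bounds X pos refl] weighted_law[OF assms(2) w' bounds' X' pos c]
    have "distr (density N (\<lambda>x. ennreal (w x / ?c))) borel X
        = distr (density N' (\<lambda>x. ennreal (w' x / ?c))) borel X'"
      by (rule Levy_uniqueness[OF L(1) L(4)]) (simp only: fun_eq_iff L(2) L(5) eq simp_thms)
    with L(3)[OF A] L(6)[OF A] show ?thesis using pos c by simp
  qed
qed

text \<open>A version of the Cramer--Wold device. The coordinates are handled one at a time: if the events
  \<open>Y k \<in> A k\<close> have been prescribed for \<open>k \<in> J\<close>, then for a further index \<open>j\<close> the
  one-dimensional uniqueness theorem applies to the law of \<open>Y j\<close> under a measure weighted by the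
  indicators of these events and by a factor that depends on the remaining coordinates. Since
  such a weight must be nonnegative, the factor \<open>iexp L\<close> enters through \<open>1 + cos L\<close>
  and \<open>1 + sin L\<close>.\<close>

lemma joint_char_unique:
  fixes N :: "'a measure" and N' :: "'b measure" and Y :: "'k \<Rightarrow> 'a \<Rightarrow> real"
  assumes "prob_space N" "prob_space N'"
    and Y [measurable]: "\<And>k. Y k \<in> borel_measurable N"
    and Y' [measurable]: "\<And>k. Y' k \<in> borel_measurable N'"
    and char: "\<And>S c. finite S \<Longrightarrow>
      (\<integral>x. iexp (\<Sum>k\<in>S. c k * Y k x) \<partial>N) = (\<integral>x. iexp (\<Sum>k\<in>S. c k * Y' k x) \<partial>N')"
    and J: "finite J" and A [measurable]: "\<And>k. A k \<in> sets borel" and S: "finite S"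
  shows "(\<integral>x. complex_of_real (\<Prod>k\<in>J. indicator (A k) (Y k x)) * iexp (\<Sum>k\<in>S. c k * Y k x) \<partial>N) =
         (\<integral>x. complex_of_real (\<Prod>k\<in>J. indicator (A k) (Y' k x)) * iexp (\<Sum>k\<in>S. c k * Y' k x) \<partial>N')"
  using J S
proof (induction J arbitrary: S c rule: finite_induct)
  case empty
  then show ?case using char by simp
next
  case (insert j J)
  interpret N: prob_space N by fact
  interpret N': prob_space N' by fact
  define P where "P = (\<lambda>y. \<Prod>k\<in>J. indicator (A k) (y k) :: real)"
  define L where "L = (\<lambda>y. \<Sum>k\<in>S. c k * (y k :: real))"
  have P01: "0 \<le> P y" "P y \<le> 1" for y
    unfolding P_def by (auto intro!: prod_nonneg prod_le_1)
  have [measurable]: "(\<lambda>x. P (\<lambda>k. Y k x)) \<in> borel_measurable N" "(\<lambda>x. P (\<lambda>k. Y' k x)) \<in> borel_measurable N'"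
    "(\<lambda>x. L (\<lambda>k. Y k x)) \<in> borel_measurable N" "(\<lambda>x. L (\<lambda>k. Y' k x)) \<in> borel_measurable N'"
    unfolding P_def L_def by measurable
  \<comment> \<open>The induction hypothesis for the linear combination of \<open>L\<close> and the new coordinate.\<close>
  have IH: "(\<integral>x. complex_of_real (P (\<lambda>k. Y k x)) * iexp (a * L (\<lambda>k. Y k x) + u * Y j x) \<partial>N) =
      (\<integral>x. complex_of_real (P (\<lambda>k. Y' k x)) * iexp (a * L (\<lambda>k. Y' k x) + u * Y' j x) \<partial>N')" for a u
  proof -
    define c' where "c' = (\<lambda>k. a * (if k \<in> S then c k else 0) + (if k = j then u else 0))"
    have *: "(\<Sum>k\<in>insert j S. c' k * y k) = a * L y + u * y j" for y
    proof -
      have "(\<Sum>k\<in>insert j S. c' k * y k) = a * (\<Sum>k\<in>insert j S. (if k \<in> S then c k else 0) * y k)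
          + (\<Sum>k\<in>insert j S. if k = j then u * y k else 0)"
        unfolding c'_def sum_distrib_left sum.distrib[symmetric]
        by (intro sum.cong) (auto simp: algebra_simps)
      also have "(\<Sum>k\<in>insert j S. (if k \<in> S then c k else 0) * y k) = L y"
        unfolding L_def by (rule sum.mono_neutral_cong_right) (use \<open>finite S\<close> in auto)
      finally show ?thesis using \<open>finite S\<close> by simp
    qed
    show ?thesis
      using insert.IH[of "insert j S" c'] \<open>finite S\<close> unfolding * P_def by simp
  qed
  have int: "integrable N (\<lambda>x. complex_of_real (P (\<lambda>k. Y k x)) * iexp (f x))"
    if [measurable]: "f \<in> borel_measurable N" for f
    by (intro N.integrable_const_bound[of _ 1]) (use P01 in \<open>auto simp: norm_mult\<close>)
  have int': "integrable N' (\<lambda>x. complex_of_real (P (\<lambda>k. Y' k x)) * iexp (f x))"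
    if [measurable]: "f \<in> borel_measurable N'" for f
    by (intro N'.integrable_const_bound[of _ 1]) (use P01 in \<open>auto simp: norm_mult\<close>)
  \<comment> \<open>For a trigonometric polynomial \<open>q \<ge> 0\<close> of degree one in \<open>L\<close>, the weighted characteristic function
    of the new coordinate is a combination of three integrals covered by the induction hypothesis.\<close>
  have weighted: "(\<integral>x. complex_of_real (P (\<lambda>k. Y k x) * indicator (A j) (Y j x) * q (L (\<lambda>k. Y k x))) \<partial>N) =
      (\<integral>x. complex_of_real (P (\<lambda>k. Y' k x) * indicator (A j) (Y' j x) * q (L (\<lambda>k. Y' k x))) \<partial>N')"
    if [measurable]: "q \<in> borel_measurable borel" and q: "\<And>l. 0 \<le> q l" "\<And>l. q l \<le> 2"
      and dec: "\<And>l. complex_of_real (q l) = \<alpha> * iexp l + \<beta> * iexp (- l) + \<gamma>"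
    for q :: "real \<Rightarrow> real" and \<alpha> \<beta> \<gamma>
  proof -
    have split: "complex_of_real (p * q l) * iexp v = \<alpha> * (complex_of_real p * iexp (1 * l + v))
        + \<beta> * (complex_of_real p * iexp ((-1) * l + v)) + \<gamma> * (complex_of_real p * iexp (0 * l + v))" for p l v
      unfolding of_real_mult dec by (simp add: algebra_simps exp_add exp_diff exp_minus divide_inverse)
    have b: "0 \<le> P y * q l" "P y * q l \<le> 2" for y l
      using P01[of y] q[of l] mult_mono[of "P y" 1 "q l" 2] by auto
    have "(\<integral>x. complex_of_real (P (\<lambda>k. Y k x) * q (L (\<lambda>k. Y k x))) * iexp (u * Y j x) \<partial>N) =
        (\<integral>x. complex_of_real (P (\<lambda>k. Y' k x) * q (L (\<lambda>k. Y' k x))) * iexp (u * Y' j x) \<partial>N')" for u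
      unfolding split
      by (simp only: IH Bochner_Integration.integral_add integral_mult_right_zero
          Bochner_Integration.integrable_add integrable_mult_right int int' borel_measurable_add
          borel_measurable_times borel_measurable_const Y Y'
          \<open>(\<lambda>x. L (\<lambda>k. Y k x)) \<in> borel_measurable N\<close> \<open>(\<lambda>x. L (\<lambda>k. Y' k x)) \<in> borel_measurable N'\<close>)
    from weighted_law_unique[OF assms(1,2) _ b _ b Y Y' this A]
    have "(\<integral>x. P (\<lambda>k. Y k x) * q (L (\<lambda>k. Y k x)) * indicator (A j) (Y j x) \<partial>N) =
        (\<integral>x. P (\<lambda>k. Y' k x) * q (L (\<lambda>k. Y' k x)) * indicator (A j) (Y' j x) \<partial>N')"
      by simp
    then show ?thesis by (simp only: integral_complex_of_real of_real_eq_iff mult_ac)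
  qed
  have "complex_of_real (cos l) = (1/2) * iexp l + (1/2) * iexp (- l)"
    "complex_of_real (sin l) = - (\<i>/2) * iexp l + (\<i>/2) * iexp (- l)" for l
    by (simp_all add: cos_exp_eq sin_exp_eq flip: cos_of_real sin_of_real) (simp add: field_simps)
  note cossin = this
  have sin_lower: "0 \<le> 1 + sin l" for l :: real using sin_ge_minus_one[of l] by linarith
  have cos_lower: "0 \<le> 1 + cos l" for l :: real using cos_ge_minus_one[of l] by linarith
  let ?I = "\<lambda>q. (\<integral>x. complex_of_real (P (\<lambda>k. Y k x) * indicator (A j) (Y j x) * q (L (\<lambda>k. Y k x))) \<partial>N)"
  let ?I' = "\<lambda>q. (\<integral>x. complex_of_real (P (\<lambda>k. Y' k x) * indicator (A j) (Y' j x) * q (L (\<lambda>k. Y' k x))) \<partial>N')"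
  have "?I (\<lambda>l. 1 + cos l) = ?I' (\<lambda>l. 1 + cos l)"
    by (rule weighted[of _ "1/2" "1/2" 1]) (auto simp: cossin cos_lower)
  moreover have "?I (\<lambda>l. 1 + sin l) = ?I' (\<lambda>l. 1 + sin l)"
    by (rule weighted[of _ "-\<i>/2" "\<i>/2" 1]) (auto simp: cossin sin_lower)
  moreover have "?I (\<lambda>l. 1) = ?I' (\<lambda>l. 1)"
    by (rule weighted[of _ 0 0 1]) auto
  moreover have split: "complex_of_real (r * i) * iexp l = complex_of_real (r * i * (1 + cos l))
      + \<i> * complex_of_real (r * i * (1 + sin l)) - (1 + \<i>) * complex_of_real (r * i * 1)" for r i l
    by (simp add: cis_conv_exp[symmetric] complex_eq_iff algebra_simps)
  moreover have b: "\<bar>P y * indicator (A j) v * q\<bar> \<le> 2" if "\<bar>q\<bar> \<le> 2" for y v q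
    using mult_mono[of "P y" 1 "\<bar>q\<bar>" 2] P01[of y] that by (auto simp: indicator_def abs_mult)
  have i: "integrable N (\<lambda>x. complex_of_real (P (\<lambda>k. Y k x) * indicator (A j) (Y j x) * q (L (\<lambda>k. Y k x))))"
    "integrable N' (\<lambda>x. complex_of_real (P (\<lambda>k. Y' k x) * indicator (A j) (Y' j x) * q (L (\<lambda>k. Y' k x))))"
    if [measurable]: "q \<in> borel_measurable borel" and "\<And>l. \<bar>q l\<bar> \<le> 2" for q
    by (intro N.integrable_const_bound[of _ 2] N'.integrable_const_bound[of _ 2] AE_I2;
        (simp only: norm_of_real b that)?; measurable)+
  have b2: "\<bar>1 + cos l\<bar> \<le> 2" "\<bar>1 + sin l\<bar> \<le> 2" "\<bar>1\<bar> \<le> (2::real)" for l :: real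
    using sin_ge_minus_one[of l] cos_ge_minus_one[of l] sin_le_one[of l] cos_le_one[of l] by linarith+
  have j: "(\<Prod>k\<in>insert j J. indicator (A k) (y k)) = P y * indicator (A j) (y j)" for y
    using insert.hyps by (simp add: P_def)
  have m: "(\<lambda>l::real. 1 + cos l) \<in> borel_measurable borel" "(\<lambda>l::real. 1 + sin l) \<in> borel_measurable borel"
    "(\<lambda>l::real. 1::real) \<in> borel_measurable borel" by measurable
  note i3 = i[of "\<lambda>l. 1 + cos l", OF m(1) b2(1)] i[of "\<lambda>l. 1 + sin l", OF m(2) b2(2)] i[of "\<lambda>l. 1", OF m(3) b2(3)]
  have L: "(\<Sum>k\<in>S. c k * y k) = L y" for y
    by (simp add: L_def)
  show ?case
    unfolding L j
    unfolding split
    by (simp only: Bochner_Integration.integral_diff Bochner_Integration.integral_add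
        integral_mult_right_zero Bochner_Integration.integrable_add integrable_mult_right i3 calculation)
qed

lemma joint_law_unique:
  fixes N :: "'a measure" and N' :: "'b measure" and Y :: "'k \<Rightarrow> 'a \<Rightarrow> real"
  assumes "prob_space N" "prob_space N'"
    and Y [measurable]: "\<And>k. Y k \<in> borel_measurable N"
    and Y' [measurable]: "\<And>k. Y' k \<in> borel_measurable N'"
    and char: "\<And>S c. finite S \<Longrightarrow>
      (\<integral>x. iexp (\<Sum>k\<in>S. c k * Y k x) \<partial>N) = (\<integral>x. iexp (\<Sum>k\<in>S. c k * Y' k x) \<partial>N')"
  shows "distr N (\<Pi>\<^sub>M k\<in>UNIV. borel) (\<lambda>x k. Y k x) = distr N' (\<Pi>\<^sub>M k\<in>UNIV. borel) (\<lambda>x k. Y' k x)"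
proof -
  interpret N: prob_space N by fact
  interpret N': prob_space N' by fact
  have m [measurable]: "(\<lambda>x k. Y k x) \<in> measurable N (\<Pi>\<^sub>M k\<in>UNIV. borel)"
    "(\<lambda>x k. Y' k x) \<in> measurable N' (\<Pi>\<^sub>M k\<in>UNIV. borel)"
    by (rule measurable_PiM_single'; auto)+
  show ?thesis
  proof (rule measure_eqI_PiM_infinite)
    show "finite_measure (distr N (\<Pi>\<^sub>M k\<in>UNIV. borel) (\<lambda>x k. Y k x))"
      by (intro N.finite_measure_distr m)
    fix A :: "'k \<Rightarrow> real set" and J :: "'k set"
    assume J: "finite J" and A: "\<And>i. i \<in> J \<Longrightarrow> A i \<in> sets borel"
    \<comment> \<open>The joint uniqueness lemma takes a Borel set at every index, also off \<open>J\<close>.\<close>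
    define A' where "A' = (\<lambda>k. if k \<in> J then A k else {})"
    have [measurable]: "A' k \<in> sets borel" for k using A by (auto simp: A'_def)
    let ?C = "{y. \<forall>k\<in>J. y k \<in> A' k}"
    have emb: "prod_emb UNIV (\<lambda>k. borel) J (Pi\<^sub>E J A) = ?C"
      by (auto simp: prod_emb_def A'_def PiE_iff restrict_def)
    have C [measurable]: "?C \<in> sets (\<Pi>\<^sub>M k\<in>UNIV. borel)"
      unfolding emb[symmetric] by (intro sets_PiM_I J) (use A in auto)
    have ind: "(\<Prod>k\<in>J. indicator (A' k) (y k)) = (indicator ?C y :: real)" for y
      using J by (auto simp: indicator_def prod_eq_1_iff intro!: prod_zero)
    have "complex_of_real (\<integral>x. indicator ?C (\<lambda>k. Y k x) \<partial>N) = complex_of_real (\<integral>x. indicator ?C (\<lambda>k. Y' k x) \<partial>N')"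
      using joint_char_unique[OF assms(1,2) Y Y' char J, of A' "{}"]
      by (simp add: ind integral_complex_of_real)
    then have eq: "(\<integral>x. indicator ?C (\<lambda>k. Y k x) \<partial>N) = (\<integral>x. indicator ?C (\<lambda>k. Y' k x) \<partial>N' :: real)"
      by (simp only: of_real_eq_iff)
    interpret D: prob_space "distr N (\<Pi>\<^sub>M k\<in>UNIV. borel) (\<lambda>x k. Y k x)"
      by (rule N.prob_space_distr[OF m(1)])
    interpret D': prob_space "distr N' (\<Pi>\<^sub>M k\<in>UNIV. borel) (\<lambda>x k. Y' k x)"
      by (rule N'.prob_space_distr[OF m(2)])
    have "measure (distr N (\<Pi>\<^sub>M k\<in>UNIV. borel) (\<lambda>x k. Y k x)) ?C = (\<integral>x. indicator ?C (\<lambda>k. Y k x) \<partial>N)"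
      by (subst integral_distr[OF m(1), symmetric]) (use C in auto)
    moreover have "measure (distr N' (\<Pi>\<^sub>M k\<in>UNIV. borel) (\<lambda>x k. Y' k x)) ?C = (\<integral>x. indicator ?C (\<lambda>k. Y' k x) \<partial>N')"
      by (subst integral_distr[OF m(2), symmetric]) (use C in auto)
    ultimately show "emeasure (distr N (\<Pi>\<^sub>M k\<in>UNIV. borel) (\<lambda>x k. Y k x)) (prod_emb UNIV (\<lambda>k. borel) J (Pi\<^sub>E J A))
        = emeasure (distr N' (\<Pi>\<^sub>M k\<in>UNIV. borel) (\<lambda>x k. Y' k x)) (prod_emb UNIV (\<lambda>k. borel) J (Pi\<^sub>E J A))"
      unfolding emb D.emeasure_eq_measure D'.emeasure_eq_measure eq by simp
  qed simp_all
qed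

section \<open>Gaussian laws\<close>

lemma second_moment_of_law:
  fixes X :: "'w \<Rightarrow> real"
  assumes [measurable]: "X \<in> borel_measurable M"
    and law: "distr M borel X = distr std_normal_distribution borel (\<lambda>t. s * t)"
  shows "has_bochner_integral M (\<lambda>\<omega>. (X \<omega>)\<^sup>2) (s\<^sup>2)"
proof -
  have "has_bochner_integral std_normal_distribution (\<lambda>t. t\<^sup>2) 1"
    using std_normal_moment_even[of 1] by (subst has_bochner_integral_density) auto
  then have "has_bochner_integral std_normal_distribution (\<lambda>t. s\<^sup>2 * t\<^sup>2) (s\<^sup>2 * 1)"
    by (rule has_bochner_integral_mult_right)
  then have "has_bochner_integral (distr M borel X) (\<lambda>t. t\<^sup>2) (s\<^sup>2)"
    unfolding law by (subst has_bochner_integral_distr) (auto simp: power_mult_distrib)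
  then show ?thesis by (simp add: has_bochner_integral_iff integrable_distr_eq integral_distr)
qed

text \<open>The law of a centered Gaussian family with covariance \<open>h i \<bullet> h j\<close>. Every linear combination of
  the coordinates is a multiple of one standard normal variable, which also covers the degenerate
  case.\<close>

locale gaussian_law =
  fixes \<gamma> :: "('i::countable \<Rightarrow> real) measure" and h :: "'i \<Rightarrow> 'h::real_inner"
  assumes sets_eq [simp, measurable_cong]: "sets \<gamma> = sets borel"
    and law: "finite S \<Longrightarrow> distr \<gamma> borel (\<lambda>x. \<Sum>i\<in>S. c i * x i) =
      distr std_normal_distribution borel (\<lambda>t. norm (\<Sum>i\<in>S. c i *\<^sub>R h i) * t)"
begin

lemma coordinate_measurable [measurable]: "(\<lambda>x. x i) \<in> borel_measurable \<gamma>"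
  unfolding measurable_cong_sets[OF sets_eq refl]
  by (rule borel_measurable_continuous_onI) (rule continuous_on_product_coordinates)

lemma space_eq [simp]: "space \<gamma> = UNIV"
  using sets_eq_imp_space_eq[OF sets_eq] by simp

sublocale prob_space \<gamma>
proof -
  interpret std: real_distribution std_normal_distribution by (rule real_dist_normal_dist)
  have "prob_space (distr \<gamma> borel (\<lambda>x. \<Sum>i\<in>{}. 0 * x i :: real))"
    unfolding law[OF finite.emptyI] by (rule std.prob_space_distr) simp
  then show "prob_space \<gamma>" by (rule prob_space_distrD[rotated]) simp
qed

lemma char_linear_combination:
  assumes "finite S"
  shows "(\<integral>x. iexp (\<Sum>i\<in>S. c i * x i) \<partial>\<gamma>) = complex_of_real (exp (- (norm (\<Sum>i\<in>S. c i *\<^sub>R h i))\<^sup>2 / 2))"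
proof -
  have "(\<integral>x. iexp (\<Sum>i\<in>S. c i * x i) \<partial>\<gamma>) = (\<integral>t. iexp t \<partial>distr \<gamma> borel (\<lambda>x. \<Sum>i\<in>S. c i * x i))"
    by (subst integral_distr) auto
  also have "\<dots> = char std_normal_distribution (norm (\<Sum>i\<in>S. c i *\<^sub>R h i))"
    unfolding law[OF assms] char_def by (subst integral_distr) auto
  finally show ?thesis by (simp add: char_std_normal_distribution)
qed

lemma abs_moment_linear_combination:
  assumes "finite S"
  shows "has_bochner_integral \<gamma> (\<lambda>x. \<bar>\<Sum>i\<in>S. c i * x i\<bar>) (sqrt (2 / pi) * norm (\<Sum>i\<in>S. c i *\<^sub>R h i))"
proof -
  let ?n = "norm (\<Sum>i\<in>S. c i *\<^sub>R h i)"
  have "has_bochner_integral std_normal_distribution (\<lambda>t. \<bar>t\<bar> ) (sqrt (2 / pi))"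
    using std_normal_moment_abs_odd[of 0] by (subst has_bochner_integral_density) auto
  then have "has_bochner_integral std_normal_distribution (\<lambda>t. \<bar>t\<bar> * ?n) (sqrt (2 / pi) * ?n)"
    by (rule has_bochner_integral_mult_left)
  then have "has_bochner_integral (distr \<gamma> borel (\<lambda>x. \<Sum>i\<in>S. c i * x i)) (\<lambda>t. \<bar>t\<bar>) (sqrt (2 / pi) * ?n)"
    unfolding law[OF assms]
    by (subst has_bochner_integral_distr) (auto simp: o_def abs_mult mult.commute)
  then show ?thesis by (simp add: has_bochner_integral_iff integrable_distr_eq integral_distr)
qed

lemma second_moment_linear_combination:
  assumes "finite S"
  shows "has_bochner_integral \<gamma> (\<lambda>x. (\<Sum>i\<in>S. c i * x i)\<^sup>2) ((norm (\<Sum>i\<in>S. c i *\<^sub>R h i))\<^sup>2)"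
  by (rule second_moment_of_law[OF _ law[OF assms]]) measurable

text \<open>By polarization; the law only prescribes second moments of linear combinations.\<close>

lemma covariance: "has_bochner_integral \<gamma> (\<lambda>x. x i * x j) (h i \<bullet> h j)"
proof (cases "i = j")
  case True
  then show ?thesis
    using second_moment_linear_combination[of "{i}" "\<lambda>_. 1"]
    by (simp add: power2_eq_square dot_square_norm)
next
  case False
  have p: "has_bochner_integral \<gamma> (\<lambda>x. (x i + x j)\<^sup>2) ((norm (h i + h j))\<^sup>2)"
    using second_moment_linear_combination[of "{i, j}" "\<lambda>_. 1"] False by simp
  have m: "has_bochner_integral \<gamma> (\<lambda>x. (x i + - x j)\<^sup>2) ((norm (h i - h j))\<^sup>2)"
    using second_moment_linear_combination[of "{i, j}" "\<lambda>k. if k = i then 1 else -1"] False by simp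
  have "has_bochner_integral \<gamma> (\<lambda>x. ((x i + x j)\<^sup>2 - (x i + - x j)\<^sup>2) / 4)
      (((norm (h i + h j))\<^sup>2 - (norm (h i - h j))\<^sup>2) / 4)"
    by (intro has_bochner_integral_divide_zero has_bochner_integral_diff p m) 
  moreover have "((norm (h i + h j))\<^sup>2 - (norm (h i - h j))\<^sup>2) / 4 = h i \<bullet> h j"
    by (simp add: power2_norm_eq_inner inner_add inner_diff inner_commute)
  moreover have "((a + b)\<^sup>2 - (a + - b)\<^sup>2) / 4 = a * b" for a b :: real
    by (simp add: power2_eq_square algebra_simps)
  ultimately show ?thesis by simp
qed

text \<open>Rotating two independent copies changes neither their joint characteristic function nor, by
  uniqueness, their joint law. The two copies are treated as one family indexed by \<open>bool \<times> 'i\<close>.\<close>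

lemma rotation_invariant:
  assumes \<Psi> [measurable]: "\<Psi> \<in> borel_measurable (borel \<Otimes>\<^sub>M borel)"
  shows "(\<integral>\<^sup>+p. \<Psi> (\<lambda>i. cos s * fst p i + sin s * snd p i, \<lambda>i. - sin s * fst p i + cos s * snd p i) \<partial>(\<gamma> \<Otimes>\<^sub>M \<gamma>))
       = (\<integral>\<^sup>+p. \<Psi> p \<partial>(\<gamma> \<Otimes>\<^sub>M \<gamma>))"
proof -
  interpret P: pair_prob_space \<gamma> \<gamma> ..
  define Z where "Z = (\<lambda>a b (k :: bool \<times> 'i) (p :: ('i \<Rightarrow> real) \<times> ('i \<Rightarrow> real)).
    if fst k then a * fst p (snd k) + b * snd p (snd k) else - b * fst p (snd k) + a * snd p (snd k))"
  have Z [measurable]: "Z a b k \<in> borel_measurable (\<gamma> \<Otimes>\<^sub>M \<gamma>)" for a b k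
    unfolding Z_def by measurable
  have char: "(\<integral>p. iexp (\<Sum>k\<in>S. c k * Z a b k p) \<partial>(\<gamma> \<Otimes>\<^sub>M \<gamma>)) =
      complex_of_real (exp (- ((norm (\<Sum>i\<in>snd ` S. c' (True, i) *\<^sub>R h i))\<^sup>2
                           + (norm (\<Sum>i\<in>snd ` S. c' (False, i) *\<^sub>R h i))\<^sup>2) / 2))"
    if S: "finite S" and ab: "a\<^sup>2 + b\<^sup>2 = 1" and c': "c' = (\<lambda>k. if k \<in> S then c k else 0)" for S c c' a b
  proof -
    let ?T = "snd ` S"
    define u where "u = (\<lambda>i. c' (True, i))"
    define v where "v = (\<lambda>i. c' (False, i))"
    have "(\<Sum>k\<in>S. c k * Z a b k p) = (\<Sum>k\<in>UNIV \<times> ?T. c' k * Z a b k p)" for p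
      unfolding c' by (rule sum.mono_neutral_cong_left) (use S in \<open>auto simp: image_iff\<close>, force)
    also have "\<dots> p = (\<Sum>i\<in>?T. u i * (a * fst p i + b * snd p i) + v i * (- b * fst p i + a * snd p i))" for p
      by (subst sum.cartesian_product')
        (simp add: UNIV_bool Z_def u_def v_def sum.distrib add.commute)
    also have "\<dots> p = (\<Sum>i\<in>?T. (a * u i - b * v i) * fst p i) + (\<Sum>i\<in>?T. (b * u i + a * v i) * snd p i)" for p
      unfolding sum.distrib[symmetric] by (intro sum.cong) (auto simp: algebra_simps)
    finally have "(\<integral>p. iexp (\<Sum>k\<in>S. c k * Z a b k p) \<partial>(\<gamma> \<Otimes>\<^sub>M \<gamma>)) =
        (\<integral>p. iexp (\<Sum>i\<in>?T. (a * u i - b * v i) * fst p i) * iexp (\<Sum>i\<in>?T. (b * u i + a * v i) * snd p i) \<partial>(\<gamma> \<Otimes>\<^sub>M \<gamma>))"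
      by (simp add: exp_add[symmetric] algebra_simps)
    also have "\<dots> = (\<integral>x. iexp (\<Sum>i\<in>?T. (a * u i - b * v i) * x i) * (\<integral>y. iexp (\<Sum>i\<in>?T. (b * u i + a * v i) * y i) \<partial>\<gamma>) \<partial>\<gamma>)"
      by (subst P.integral_fst'[symmetric])
        (auto intro!: P.integrable_const_bound[of _ 1] simp: norm_mult)
    also have "\<dots> = complex_of_real (exp (- (norm (\<Sum>i\<in>?T. (a * u i - b * v i) *\<^sub>R h i))\<^sup>2 / 2))
        * complex_of_real (exp (- (norm (\<Sum>i\<in>?T. (b * u i + a * v i) *\<^sub>R h i))\<^sup>2 / 2))"
      using S by (simp only: char_linear_combination finite_imageI integral_mult_left_zero)
    also have "(\<Sum>i\<in>?T. (a * u i - b * v i) *\<^sub>R h i) = a *\<^sub>R (\<Sum>i\<in>?T. u i *\<^sub>R h i) - b *\<^sub>R (\<Sum>i\<in>?T. v i *\<^sub>R h i)"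
      by (simp add: scaleR_sum_right sum_subtractf[symmetric] algebra_simps)
    also have "(\<Sum>i\<in>?T. (b * u i + a * v i) *\<^sub>R h i) = b *\<^sub>R (\<Sum>i\<in>?T. u i *\<^sub>R h i) + a *\<^sub>R (\<Sum>i\<in>?T. v i *\<^sub>R h i)"
      by (simp add: scaleR_sum_right sum.distrib[symmetric] algebra_simps)
    also have "complex_of_real (exp (- (norm (a *\<^sub>R U - b *\<^sub>R V))\<^sup>2 / 2)) * complex_of_real (exp (- (norm (b *\<^sub>R U + a *\<^sub>R V))\<^sup>2 / 2))
        = complex_of_real (exp (- ((norm U)\<^sup>2 + (norm V)\<^sup>2) / 2))" for U V :: 'h
    proof -
      have "(norm (a *\<^sub>R U - b *\<^sub>R V))\<^sup>2 + (norm (b *\<^sub>R U + a *\<^sub>R V))\<^sup>2 = (a\<^sup>2 + b\<^sup>2) * ((norm U)\<^sup>2 + (norm V)\<^sup>2)"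
        by (simp add: power2_norm_eq_inner inner_add inner_diff inner_commute) (simp add: power2_eq_square algebra_simps)
      then have "- (norm (a *\<^sub>R U - b *\<^sub>R V))\<^sup>2 / 2 + - (norm (b *\<^sub>R U + a *\<^sub>R V))\<^sup>2 / 2 = - ((norm U)\<^sup>2 + (norm V)\<^sup>2) / 2"
        unfolding ab by (simp add: field_simps)
      then show ?thesis by (simp only: of_real_mult[symmetric] exp_add[symmetric])
    qed
    finally show ?thesis by (simp add: u_def v_def)
  qed
  have eq: "distr (\<gamma> \<Otimes>\<^sub>M \<gamma>) (\<Pi>\<^sub>M k\<in>UNIV. borel) (\<lambda>p k. Z (cos s) (sin s) k p) =
      distr (\<gamma> \<Otimes>\<^sub>M \<gamma>) (\<Pi>\<^sub>M k\<in>UNIV. borel) (\<lambda>p k. Z 1 0 k p)"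
  proof (rule joint_law_unique)
    fix S :: "(bool \<times> 'i) set" and c assume "finite S"
    from char[OF this, of "cos s" "sin s"] char[OF this, of 1 0]
    show "(\<integral>p. iexp (\<Sum>k\<in>S. c k * Z (cos s) (sin s) k p) \<partial>(\<gamma> \<Otimes>\<^sub>M \<gamma>)) =
        (\<integral>p. iexp (\<Sum>k\<in>S. c k * Z 1 0 k p) \<partial>(\<gamma> \<Otimes>\<^sub>M \<gamma>))" by simp
  qed (auto intro: P.prob_space_axioms)
  have m [measurable]: "(\<lambda>p k. Z a b k p) \<in> measurable (\<gamma> \<Otimes>\<^sub>M \<gamma>) (\<Pi>\<^sub>M k\<in>UNIV. borel)" for a b
    by (rule measurable_PiM_single') auto
  have [measurable]: "(\<lambda>z i. z (t, i)) \<in> measurable (\<Pi>\<^sub>M k\<in>(UNIV :: (bool \<times> 'i) set). borel) (borel :: ('i \<Rightarrow> real) measure)" for t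
    unfolding measurable_cong_sets[OF refl sets_PiM_equal_borel[symmetric]]
    by (rule measurable_PiM_single') auto
  define \<Phi> where "\<Phi> z = \<Psi> (\<lambda>i. z (True, i), \<lambda>i. z (False, i))" for z
  have [measurable]: "\<Phi> \<in> borel_measurable (\<Pi>\<^sub>M k\<in>UNIV. borel)"
    unfolding \<Phi>_def by measurable
  have "(\<integral>\<^sup>+p. \<Phi> (\<lambda>k. Z (cos s) (sin s) k p) \<partial>(\<gamma> \<Otimes>\<^sub>M \<gamma>)) = (\<integral>\<^sup>+p. \<Phi> (\<lambda>k. Z 1 0 k p) \<partial>(\<gamma> \<Otimes>\<^sub>M \<gamma>))"
    using arg_cong[OF eq, of "\<lambda>\<mu>. nn_integral \<mu> \<Phi>"] by (simp add: nn_integral_distr)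
  then show ?thesis by (simp add: \<Phi>_def Z_def)
qed

end

section \<open>Derivatives along paths\<close>

text \<open>Pairing with the unit vector in the direction of the increment reduces the estimate to the
  fundamental theorem for real functions, so that no integral of a vector-valued function occurs and
  \<open>'k\<close> may be any inner product space.\<close>

lemma norm_diff_le_nn_integral_derivative:
  fixes g :: "real \<Rightarrow> 'k::real_inner"
  assumes "a \<le> b" and deriv: "\<And>s. (g has_vector_derivative g' s) (at s)" and cont: "continuous_on UNIV g'"
  shows "ennreal (norm (g b - g a)) \<le> (\<integral>\<^sup>+s\<in>{a..b}. ennreal (norm (g' s)) \<partial>lborel)"
proof -
  define u where "u = sgn (g b - g a)"
  have u: "norm u \<le> 1" by (simp add: u_def norm_sgn)
  have cont': "continuous_on {a..b} (\<lambda>s. u \<bullet> g' s)"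
    by (intro continuous_intros continuous_on_subset[OF cont]) auto
  have "((\<lambda>s. u \<bullet> g s) has_vector_derivative u \<bullet> g' s) (at s within {a..b})" for s
    using bounded_linear.has_vector_derivative[OF bounded_linear_inner_right deriv]
    by (rule has_vector_derivative_at_within)
  then have FTC: "(\<integral>s. indicator {a..b} s *\<^sub>R (u \<bullet> g' s) \<partial>lborel) = u \<bullet> g b - u \<bullet> g a"
    by (intro integral_FTC_atLeastAtMost[OF \<open>a \<le> b\<close> _ cont'])
  have "norm (g b - g a) = u \<bullet> g b - u \<bullet> g a"
    unfolding inner_diff_right[symmetric] by (cases "g b = g a") (simp_all add: u_def sgn_div_norm dot_square_norm power2_eq_square)
  then have "ennreal (norm (g b - g a)) \<le> ennreal (norm (\<integral>s. indicator {a..b} s *\<^sub>R (u \<bullet> g' s) \<partial>lborel))"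
    unfolding FTC by (intro ennreal_leI) simp
  also have "\<dots> \<le> (\<integral>\<^sup>+s. ennreal (norm (indicator {a..b} s *\<^sub>R (u \<bullet> g' s))) \<partial>lborel)"
    using borel_integrable_atLeastAtMost'[OF cont'] unfolding set_integrable_def
    by (rule integral_norm_bound_ennreal)
  also have "\<dots> \<le> (\<integral>\<^sup>+s\<in>{a..b}. ennreal (norm (g' s)) \<partial>lborel)"
  proof (intro nn_integral_mono)
    fix s
    have "\<bar>u \<bullet> g' s\<bar> \<le> norm u * norm (g' s)" by (rule Cauchy_Schwarz_ineq2)
    also have "\<dots> \<le> norm (g' s)" using u by (simp add: mult_left_le_one_le)
    finally show "ennreal (norm (indicator {a..b} s *\<^sub>R (u \<bullet> g' s))) \<le> ennreal (norm (g' s)) * indicator {a..b} s"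
      by (auto simp: indicator_def intro: ennreal_leI)
  qed
  finally show ?thesis .
qed

lemma tendsto_coordinatewise:
  fixes f :: "'a \<Rightarrow> 'i \<Rightarrow> 'b::topological_space"
  assumes "\<And>i. ((\<lambda>r. f r i) \<longlongrightarrow> l i) F"
  shows "(f \<longlongrightarrow> l) F"
  using assms limitin_componentwise[of "\<lambda>_. euclidean" "UNIV :: 'i set" f l F]
  by (simp add: euclidean_product_topology)

lemma MVT_unordered:
  fixes f :: "real \<Rightarrow> real"
  assumes "\<And>t. (f has_real_derivative f' t) (at t)"
  shows "\<exists>\<xi>. \<bar>\<xi> - a\<bar> \<le> \<bar>b - a\<bar> \<and> f b - f a = f' \<xi> * (b - a)"
proof (cases a b rule: linorder_cases)
  case less
  from MVT2[OF this assms] obtain z where "a < z" "z < b" "f b - f a = (b - a) * f' z" by blast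
  then show ?thesis by (intro exI[of _ z]) auto
next
  case equal
  then show ?thesis by auto
next
  case greater
  from MVT2[OF this assms] obtain z where "b < z" "z < a" "f a - f b = (a - b) * f' z" by blast
  then show ?thesis by (intro exI[of _ z]) (auto simp: algebra_simps)
qed

text \<open>Continuous partial derivatives yield the chain rule: the increment of \<open>g\<close> along the path is
  telescoped by moving one coordinate at a time, and each step is handled by the mean value
  theorem.\<close>

lemma chain_rule_partials:
  fixes g :: "(nat \<Rightarrow> real) \<Rightarrow> real"
  assumes dep: "\<And>x y. (\<And>i. i < m \<Longrightarrow> x i = y i) \<Longrightarrow> g x = g y"
    and cont: "\<And>i. i < m \<Longrightarrow> continuous_on UNIV (partial i g)"
    and diff: "\<And>i x. i < m \<Longrightarrow> (\<lambda>t. g (x(i := t))) differentiable (at (x i))"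
    and p: "\<And>i. i < m \<Longrightarrow> ((\<lambda>r. p r i) has_real_derivative q i) (at s)"
  shows "((\<lambda>r. g (p r)) has_real_derivative (\<Sum>i<m. partial i g (p s) * q i)) (at s)"
proof -
  \<comment> \<open>The coordinates from \<open>m\<close> on are frozen at \<open>0\<close>: the path need not be continuous in them.\<close>
  define mix where "mix = (\<lambda>k r i. if i < k then p r i else if i < m then p s i else 0)"
  have deriv: "((\<lambda>t. g (x(k := t))) has_real_derivative partial k g (x(k := t))) (at t)" if "k < m" for k x t
    using diff[OF that, of "x(k := t)"] by (simp add: partial_def DERIV_deriv_iff_real_differentiable)
  have step: "\<exists>\<xi>. \<bar>\<xi> - p s k\<bar> \<le> \<bar>p r k - p s k\<bar> \<and>
      g (mix (Suc k) r) - g (mix k r) = partial k g ((mix k r)(k := \<xi>)) * (p r k - p s k)" if "k < m" for k r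
  proof -
    have "mix (Suc k) r = (mix k r)(k := p r k)" "mix k r = (mix k r)(k := p s k)"
      using that by (auto simp: mix_def fun_eq_iff less_Suc_eq)
    with MVT_unordered[of "\<lambda>t. g ((mix k r)(k := t))" "\<lambda>t. partial k g ((mix k r)(k := t))" "p s k" "p r k", OF deriv[OF that]]
    show ?thesis by (metis (no_types))
  qed
  then obtain \<xi> where \<xi>: "\<And>k r. k < m \<Longrightarrow> \<bar>\<xi> k r - p s k\<bar> \<le> \<bar>p r k - p s k\<bar>"
    "\<And>k r. k < m \<Longrightarrow> g (mix (Suc k) r) - g (mix k r) = partial k g ((mix k r)(k := \<xi> k r)) * (p r k - p s k)"
    by metis
  have telescope: "g (p r) - g (p s) = (\<Sum>k<m. partial k g ((mix k r)(k := \<xi> k r)) * (p r k - p s k))" for r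
  proof -
    have "g (p r) = g (mix m r)" "g (p s) = g (mix 0 r)"
      by (intro dep; simp add: mix_def)+
    then have "g (p r) - g (p s) = (\<Sum>k<m. g (mix (Suc k) r) - g (mix k r))"
      using sum_lessThan_telescope[of "\<lambda>k. g (mix k r)" m] by simp
    then show ?thesis using \<xi>(2) by simp
  qed
  have pc: "((\<lambda>r. p r i) \<longlongrightarrow> p s i) (at s)" if "i < m" for i
    using DERIV_isCont[OF p[OF that]] by (simp add: isCont_def)
  have "((\<lambda>r. (mix k r)(k := \<xi> k r)) \<longlongrightarrow> mix m s) (at s)" if k: "k < m" for k
  proof (rule tendsto_coordinatewise)
    fix i
    have "((\<lambda>r. \<xi> k r - p s k) \<longlongrightarrow> 0) (at s)"
    proof (rule Lim_null_comparison)
      show "((\<lambda>r. \<bar>p r k - p s k\<bar>) \<longlongrightarrow> 0) (at s)"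
        using tendsto_rabs_zero[OF LIM_zero[OF pc[OF k]]] .
    qed (use \<xi>(1)[OF k] in auto)
    then have \<xi>k: "(\<xi> k \<longlongrightarrow> p s k) (at s)" by (rule LIM_zero_cancel)
    show "((\<lambda>r. ((mix k r)(k := \<xi> k r)) i) \<longlongrightarrow> mix m s i) (at s)"
      using k \<xi>k pc[of i] by (cases "i = k"; cases "i < k"; cases "i < m"; simp add: mix_def)
  qed
  then have "((\<lambda>r. partial k g ((mix k r)(k := \<xi> k r))) \<longlongrightarrow> partial k g (mix m s)) (at s)" if "k < m" for k
    using continuous_on_tendsto_compose[OF cont[OF that]] that by auto
  moreover have "partial k g (mix m s) = partial k g (p s)" if "k < m" for k
  proof -
    have "g ((mix m s)(k := t)) = g ((p s)(k := t))" for t by (intro dep) (simp add: mix_def)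
    then show ?thesis using that by (simp add: partial_def mix_def)
  qed
  ultimately have lim: "((\<lambda>r. partial k g ((mix k r)(k := \<xi> k r))) \<longlongrightarrow> partial k g (p s)) (at s)" if "k < m" for k
    using that by simp
  show ?thesis
    unfolding has_field_derivative_iff telescope sum_divide_distrib times_divide_eq_right[symmetric]
    by (intro tendsto_sum tendsto_mult lim) (use p in \<open>auto simp: has_field_derivative_iff\<close>)
qed

definition comb :: "real \<Rightarrow> ('i \<Rightarrow> real) \<Rightarrow> real \<Rightarrow> ('i \<Rightarrow> real) \<Rightarrow> 'i \<Rightarrow> real" where
  "comb a x b y = (\<lambda>i. a * x i + b * y i)"

lemma continuous_on_comb [continuous_intros]:
  assumes "continuous_on S a" "continuous_on S x" "continuous_on S b" "continuous_on S y"
  shows "continuous_on S (\<lambda>t. comb (a t) (x t) (b t) (y t))"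
  unfolding comb_def
  by (intro continuous_on_coordinatewise_then_product continuous_on_add continuous_on_mult assms(1,3)
      continuous_on_product_then_coordinatewise[OF assms(2)] continuous_on_product_then_coordinatewise[OF assms(4)])

lemma measurable_comb [measurable (raw)]:
  fixes x y :: "'a \<Rightarrow> 'i::countable \<Rightarrow> real"
  assumes "a \<in> borel_measurable N" "x \<in> borel_measurable N" "b \<in> borel_measurable N" "y \<in> borel_measurable N"
  shows "(\<lambda>t. comb (a t) (x t) (b t) (y t)) \<in> borel_measurable N"
proof -
  have coordinate: "(\<lambda>z :: 'i \<Rightarrow> real. z i) \<in> borel_measurable borel" for i
    by (rule borel_measurable_continuous_onI) (rule continuous_on_product_coordinates)
  have [measurable]: "(\<lambda>t. x t i) \<in> borel_measurable N" "(\<lambda>t. y t i) \<in> borel_measurable N" for i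
    using assms(2,4) by (auto intro: measurable_compose[OF _ coordinate])
  have "(\<lambda>t. comb (a t) (x t) (b t) (y t)) \<in> measurable N (\<Pi>\<^sub>M i\<in>UNIV. borel)"
    unfolding comb_def using assms(1,3) by (intro measurable_PiM_single') auto
  then show ?thesis
    by (simp add: measurable_cong_sets[OF refl sets_PiM_equal_borel])
qed

lemma comb_has_derivative_rotation:
  "((\<lambda>s. comb (cos s) x (sin s) y i) has_real_derivative comb (- sin s) x (cos s) y i) (at s)"
  unfolding comb_def by (auto intro!: derivative_eq_intros)

section \<open>The interpolation inequality for Gaussian laws\<close>

context gaussian_law
begin

lemma nn_integral_rotation:
  assumes \<Psi> [measurable]: "case_prod \<Psi> \<in> borel_measurable (borel \<Otimes>\<^sub>M borel)"
  shows "(\<integral>\<^sup>+x. \<integral>\<^sup>+y. \<Psi> (comb (cos s) x (sin s) y) (comb (- sin s) x (cos s) y) \<partial>\<gamma> \<partial>\<gamma>)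
       = (\<integral>\<^sup>+x. \<integral>\<^sup>+y. \<Psi> x y \<partial>\<gamma> \<partial>\<gamma>)"
proof -
  interpret P: pair_prob_space \<gamma> \<gamma> ..
  have "(\<lambda>p. \<Psi> (comb (cos s) (fst p) (sin s) (snd p)) (comb (- sin s) (fst p) (cos s) (snd p)))
      \<in> borel_measurable (\<gamma> \<Otimes>\<^sub>M \<gamma>)" by measurable
  from nn_integral_fst[OF this] nn_integral_fst[of "case_prod \<Psi>" \<gamma>] rotation_invariant[OF \<Psi>, of s]
  show ?thesis by (simp add: comb_def)
qed

text \<open>At each time a rotating pair has the law of two independent copies, so averaging over a rotation
  of angle \<open>b\<close> costs exactly the factor \<open>b\<close>.\<close>

lemma nn_integral_rotation_path:
  assumes \<Psi> [measurable]: "case_prod \<Psi> \<in> borel_measurable (borel \<Otimes>\<^sub>M borel)" and "0 \<le> b"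
  shows "(\<integral>\<^sup>+x. \<integral>\<^sup>+y. (\<integral>\<^sup>+s\<in>{0..b}. \<Psi> (comb (cos s) x (sin s) y) (comb (- sin s) x (cos s) y) \<partial>lborel) \<partial>\<gamma> \<partial>\<gamma>)
       = ennreal b * (\<integral>\<^sup>+x. \<integral>\<^sup>+y. \<Psi> x y \<partial>\<gamma> \<partial>\<gamma>)"
proof -
  interpret Q: pair_sigma_finite lborel \<gamma> ..
  let ?f = "\<lambda>x y s. \<Psi> (comb (cos s) x (sin s) y) (comb (- sin s) x (cos s) y)"
  have "(\<integral>\<^sup>+x. \<integral>\<^sup>+y. (\<integral>\<^sup>+s\<in>{0..b}. ?f x y s \<partial>lborel) \<partial>\<gamma> \<partial>\<gamma>)
      = (\<integral>\<^sup>+x. (\<integral>\<^sup>+s. \<integral>\<^sup>+y. ?f x y s * indicator {0..b} s \<partial>\<gamma> \<partial>lborel) \<partial>\<gamma>)"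
    by (intro nn_integral_cong Q.Fubini') measurable
  also have "\<dots> = (\<integral>\<^sup>+s. \<integral>\<^sup>+x. \<integral>\<^sup>+y. ?f x y s * indicator {0..b} s \<partial>\<gamma> \<partial>\<gamma> \<partial>lborel)"
    by (intro Q.Fubini') measurable
  also have "\<dots> = (\<integral>\<^sup>+s. (\<integral>\<^sup>+x. \<integral>\<^sup>+y. ?f x y s \<partial>\<gamma> \<partial>\<gamma>) * indicator {0..b} s \<partial>lborel)"
    by (intro nn_integral_cong) (simp add: nn_integral_multc)
  also have "\<dots> = (\<integral>\<^sup>+x. \<integral>\<^sup>+y. \<Psi> x y \<partial>\<gamma> \<partial>\<gamma>) * ennreal b"
    unfolding nn_integral_rotation[OF \<Psi>] using \<open>0 \<le> b\<close> by (simp add: nn_integral_cmult)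
  finally show ?thesis by (simp add: mult.commute)
qed

end

lemma borel_measurable_continuous_2:
  fixes H :: "'b::second_countable_topology \<Rightarrow> 'c::second_countable_topology \<Rightarrow> 'k::topological_space"
  assumes "continuous_on UNIV (\<lambda>p. H (fst p) (snd p))"
    and "f \<in> borel_measurable N" "g \<in> borel_measurable N"
  shows "(\<lambda>t. H (f t) (g t)) \<in> borel_measurable N"
  by (rule borel_measurable_continuous_Pair[of f N g H]) (rule assms)+

lemma borel_measurable_continuous_3:
  fixes H :: "'b::second_countable_topology \<Rightarrow> 'c::second_countable_topology \<Rightarrow> 'd::second_countable_topology
    \<Rightarrow> 'k::topological_space"
  assumes H: "continuous_on UNIV (\<lambda>p. H (fst p) (fst (snd p)) (snd (snd p)))"
    and f: "f \<in> borel_measurable N" and g: "g \<in> borel_measurable N" and e: "e \<in> borel_measurable N"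
  shows "(\<lambda>t. H (f t) (g t) (e t)) \<in> borel_measurable N"
proof -
  have "(\<lambda>t. (g t, e t)) \<in> borel_measurable N"
    by (rule borel_measurable_Pair[OF g e])
  from borel_measurable_continuous_Pair[OF f this, of "\<lambda>x p. H x (fst p) (snd p)"] H show ?thesis by simp
qed

context gaussian_law
begin

text \<open>Two rotations carry the proof. A half turn takes \<open>w\<close> to \<open>- w\<close>; along it
  \<open>U - U' x\<close>, with the base point \<open>x\<close> of the linear functional frozen at an independent copy, moves from
  \<open>U w - U' x w\<close> to \<open>U (- w) + U' x w\<close> with velocity \<open>(U' w\<^sub>s - U' x) w\<^sub>s'\<close>, whose mean norm is
  that of the difference of \<open>U'\<close> at two independent points, applied to a third copy. A quarter turn between
  these two points bounds this difference by \<open>U''\<close>. The constant is half the product of the two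
  angles \<open>pi\<close> and \<open>pi / 2\<close>.\<close>

lemma first_order_interpolation:
  fixes U :: "('i \<Rightarrow> real) \<Rightarrow> 'k::{real_inner,second_countable_topology}"
    and U' :: "('i \<Rightarrow> real) \<Rightarrow> ('i \<Rightarrow> real) \<Rightarrow> 'k"
    and U'' :: "('i \<Rightarrow> real) \<Rightarrow> ('i \<Rightarrow> real) \<Rightarrow> ('i \<Rightarrow> real) \<Rightarrow> 'k"
  assumes cont: "continuous_on UNIV U"
    and cont': "continuous_on UNIV (\<lambda>p. U' (fst p) (snd p))"
    and cont'': "continuous_on UNIV (\<lambda>p. U'' (fst p) (fst (snd p)) (snd (snd p)))"
    and linear': "\<And>x a w b z. U' x (comb a w b z) = a *\<^sub>R U' x w + b *\<^sub>R U' x z"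
    and deriv: "\<And>p q s. (\<And>i s. ((\<lambda>s. p s i) has_real_derivative q s i) (at s)) \<Longrightarrow>
      ((\<lambda>s. U (p s)) has_vector_derivative U' (p s) (q s)) (at s)"
    and deriv': "\<And>p q s y. (\<And>i s. ((\<lambda>s. p s i) has_real_derivative q s i) (at s)) \<Longrightarrow>
      ((\<lambda>s. U' (p s) y) has_vector_derivative U'' (p s) (q s) y) (at s)"
  shows "(\<integral>\<^sup>+x. \<integral>\<^sup>+w. ennreal (norm (U' x w)) \<partial>\<gamma> \<partial>\<gamma>) \<le>
    (\<integral>\<^sup>+x. ennreal (norm (U x)) \<partial>\<gamma>)
    + ennreal (pi\<^sup>2 / 4) * (\<integral>\<^sup>+x. \<integral>\<^sup>+z. \<integral>\<^sup>+y. ennreal (norm (U'' x z y)) \<partial>\<gamma> \<partial>\<gamma> \<partial>\<gamma>)"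
proof -
  note [measurable (raw)] = measurable_compose[OF _ borel_measurable_continuous_onI[OF cont]]
    borel_measurable_continuous_2[OF cont'] borel_measurable_continuous_3[OF cont'']
  have one: "emeasure \<gamma> UNIV = 1" using emeasure_space_1 by simp
  let ?rot = "\<lambda>s x y. comb (cos s) x (sin s) y"
  let ?rot' = "\<lambda>s x y. comb (- sin s) x (cos s) y"
  have crot: "continuous_on UNIV (\<lambda>s. ?rot s x y)" "continuous_on UNIV (\<lambda>s. ?rot' s x y)" for x y :: "'i \<Rightarrow> real"
    by (intro continuous_intros)+
  let ?I = "\<integral>\<^sup>+x. \<integral>\<^sup>+z. \<integral>\<^sup>+y. ennreal (norm (U'' x z y)) \<partial>\<gamma> \<partial>\<gamma> \<partial>\<gamma>"
  let ?D = "\<integral>\<^sup>+x'. \<integral>\<^sup>+x. \<integral>\<^sup>+y. ennreal (norm (U' x y - U' x' y)) \<partial>\<gamma> \<partial>\<gamma> \<partial>\<gamma>"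

  \<comment> \<open>The quarter turn from \<open>x'\<close> to \<open>x\<close>.\<close>
  have second: "?D \<le> ennreal (pi / 2) * ?I"
  proof -
    have point: "ennreal (norm (U' x y - U' x' y)) \<le>
        (\<integral>\<^sup>+s\<in>{0..pi / 2}. ennreal (norm (U'' (?rot s x' x) (?rot' s x' x) y)) \<partial>lborel)" for x x' y
    proof -
      have d: "((\<lambda>s. U' (?rot s x' x) y) has_vector_derivative U'' (?rot s x' x) (?rot' s x' x) y) (at s)" for s
        by (intro deriv' comb_has_derivative_rotation)
      have "continuous_on UNIV (\<lambda>s. U'' (?rot s x' x) (?rot' s x' x) y)"
        using continuous_on_compose2[OF cont'', of UNIV "\<lambda>s. (?rot s x' x, ?rot' s x' x, y)"]
        by (simp add: crot continuous_on_Pair)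
      from norm_diff_le_nn_integral_derivative[OF _ d this, of 0 "pi / 2"]
      show ?thesis by (simp add: comb_def)
    qed
    have "?D \<le> (\<integral>\<^sup>+x'. \<integral>\<^sup>+x. \<integral>\<^sup>+y. (\<integral>\<^sup>+s\<in>{0..pi / 2}. ennreal (norm (U'' (?rot s x' x) (?rot' s x' x) y)) \<partial>lborel) \<partial>\<gamma> \<partial>\<gamma> \<partial>\<gamma>)"
      by (intro nn_integral_mono point)
    also have "\<dots> = (\<integral>\<^sup>+x'. \<integral>\<^sup>+x. (\<integral>\<^sup>+s\<in>{0..pi / 2}. (\<integral>\<^sup>+y. ennreal (norm (U'' (?rot s x' x) (?rot' s x' x) y)) \<partial>\<gamma>) \<partial>lborel) \<partial>\<gamma> \<partial>\<gamma>)"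
    proof (intro nn_integral_cong)
      fix x' x :: "'i \<Rightarrow> real"
      interpret Q: pair_sigma_finite lborel \<gamma> ..
      have "(\<integral>\<^sup>+y. (\<integral>\<^sup>+s\<in>{0..pi / 2}. ennreal (norm (U'' (?rot s x' x) (?rot' s x' x) y)) \<partial>lborel) \<partial>\<gamma>)
        = (\<integral>\<^sup>+s. \<integral>\<^sup>+y. ennreal (norm (U'' (?rot s x' x) (?rot' s x' x) y)) * indicator {0..pi / 2} s \<partial>\<gamma> \<partial>lborel)"
        by (intro Q.Fubini') measurable
      then show "(\<integral>\<^sup>+y. (\<integral>\<^sup>+s\<in>{0..pi / 2}. ennreal (norm (U'' (?rot s x' x) (?rot' s x' x) y)) \<partial>lborel) \<partial>\<gamma>)
        = (\<integral>\<^sup>+s\<in>{0..pi / 2}. (\<integral>\<^sup>+y. ennreal (norm (U'' (?rot s x' x) (?rot' s x' x) y)) \<partial>\<gamma>) \<partial>lborel)"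
        by (simp add: nn_integral_multc)
    qed
    also have "\<dots> = ennreal (pi / 2) * ?I"
    proof -
      have "(\<lambda>(x, z). \<integral>\<^sup>+y. ennreal (norm (U'' x z y)) \<partial>\<gamma>) \<in> borel_measurable (borel \<Otimes>\<^sub>M borel)"
        by measurable
      from nn_integral_rotation_path[OF this, of "pi / 2"] show ?thesis by simp
    qed
    finally show ?thesis by simp
  qed

  \<comment> \<open>The half turn from \<open>w\<close> to \<open>- w = comb (- 1) w 0 y\<close>.\<close>
  have first: "2 * ennreal (norm (U' x w)) \<le> ennreal (norm (U w)) + ennreal (norm (U (comb (- 1) w 0 y)))
      + (\<integral>\<^sup>+s\<in>{0..pi}. ennreal (norm (U' (?rot s w y) (?rot' s w y) - U' x (?rot' s w y))) \<partial>lborel)" for x w y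
  proof -
    let ?g = "\<lambda>s. U (?rot s w y) - U' x (?rot s w y)"
    have "((\<lambda>s. U' x (?rot s w y)) has_vector_derivative U' x (?rot' s w y)) (at s)" for s
      unfolding linear' by (auto intro!: derivative_eq_intros)
    then have d: "(?g has_vector_derivative U' (?rot s w y) (?rot' s w y) - U' x (?rot' s w y)) (at s)" for s
      by (intro has_vector_derivative_diff deriv comb_has_derivative_rotation)
    have "continuous_on UNIV (\<lambda>s. U' (?rot s w y) (?rot' s w y) - U' x (?rot' s w y))"
      using continuous_on_compose2[OF cont', of UNIV "\<lambda>s. (?rot s w y, ?rot' s w y)"]
        continuous_on_compose2[OF cont', of UNIV "\<lambda>s. (x, ?rot' s w y)"]
      by (simp add: crot continuous_on_Pair continuous_on_diff)
    from norm_diff_le_nn_integral_derivative[OF _ d this, of 0 pi]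
    have *: "ennreal (norm (?g pi - ?g 0)) \<le>
      (\<integral>\<^sup>+s\<in>{0..pi}. ennreal (norm (U' (?rot s w y) (?rot' s w y) - U' x (?rot' s w y))) \<partial>lborel)" by simp
    have "U' x (comb (- 1) w 0 y) = - U' x w" "U' x (comb 1 w 0 y) = U' x w" "comb 1 w 0 y = w"
      by (simp_all add: linear') (simp add: comb_def)
    then have "2 *\<^sub>R U' x w = (?g pi - ?g 0) + U w - U (comb (- 1) w 0 y)"
      by (simp add: scaleR_2)
    then have "2 * norm (U' x w) \<le> norm (U w) + norm (U (comb (- 1) w 0 y)) + norm (?g pi - ?g 0)"
      using norm_triangle_ineq4[of "(?g pi - ?g 0) + U w" "U (comb (- 1) w 0 y)"]
        norm_triangle_ineq[of "?g pi - ?g 0" "U w"] norm_scaleR[of 2 "U' x w"]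
      by (simp del: norm_scaleR)
    then have "ennreal (2 * norm (U' x w)) \<le> ennreal (norm (U w) + norm (U (comb (- 1) w 0 y)) + norm (?g pi - ?g 0))"
      by (rule ennreal_leI)
    also have "\<dots> = ennreal (norm (U w)) + ennreal (norm (U (comb (- 1) w 0 y))) + ennreal (norm (?g pi - ?g 0))"
      by simp
    also have "\<dots> \<le> ennreal (norm (U w)) + ennreal (norm (U (comb (- 1) w 0 y)))
      + (\<integral>\<^sup>+s\<in>{0..pi}. ennreal (norm (U' (?rot s w y) (?rot' s w y) - U' x (?rot' s w y))) \<partial>lborel)"
      by (intro add_left_mono *)
    finally show ?thesis by (simp add: ennreal_mult')
  qed

  have flip: "(\<integral>\<^sup>+w. \<integral>\<^sup>+y. ennreal (norm (U (comb (- 1) w 0 y))) \<partial>\<gamma> \<partial>\<gamma>) = (\<integral>\<^sup>+w. ennreal (norm (U w)) \<partial>\<gamma>)"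
    using nn_integral_rotation[of "\<lambda>w y. ennreal (norm (U w))" pi] by (simp add: one)

  have "2 * (\<integral>\<^sup>+x. \<integral>\<^sup>+w. ennreal (norm (U' x w)) \<partial>\<gamma> \<partial>\<gamma>) = (\<integral>\<^sup>+x. \<integral>\<^sup>+w. \<integral>\<^sup>+y. 2 * ennreal (norm (U' x w)) \<partial>\<gamma> \<partial>\<gamma> \<partial>\<gamma>)"
    by (simp add: nn_integral_cmult one)
  also have "\<dots> \<le> (\<integral>\<^sup>+x. \<integral>\<^sup>+w. \<integral>\<^sup>+y. (ennreal (norm (U w)) + ennreal (norm (U (comb (- 1) w 0 y)))
      + (\<integral>\<^sup>+s\<in>{0..pi}. ennreal (norm (U' (?rot s w y) (?rot' s w y) - U' x (?rot' s w y))) \<partial>lborel)) \<partial>\<gamma> \<partial>\<gamma> \<partial>\<gamma>)"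
    by (intro nn_integral_mono first)
  also have "\<dots> = (\<integral>\<^sup>+w. ennreal (norm (U w)) \<partial>\<gamma>) + (\<integral>\<^sup>+w. ennreal (norm (U w)) \<partial>\<gamma>)
      + (\<integral>\<^sup>+x. \<integral>\<^sup>+w. \<integral>\<^sup>+y. (\<integral>\<^sup>+s\<in>{0..pi}. ennreal (norm (U' (?rot s w y) (?rot' s w y) - U' x (?rot' s w y))) \<partial>lborel) \<partial>\<gamma> \<partial>\<gamma> \<partial>\<gamma>)"
    by (simp add: nn_integral_add flip one)
  also have "(\<integral>\<^sup>+x. \<integral>\<^sup>+w. \<integral>\<^sup>+y. (\<integral>\<^sup>+s\<in>{0..pi}. ennreal (norm (U' (?rot s w y) (?rot' s w y) - U' x (?rot' s w y))) \<partial>lborel) \<partial>\<gamma> \<partial>\<gamma> \<partial>\<gamma>)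
      = (\<integral>\<^sup>+x. ennreal pi * (\<integral>\<^sup>+w. \<integral>\<^sup>+y. ennreal (norm (U' w y - U' x y)) \<partial>\<gamma> \<partial>\<gamma>) \<partial>\<gamma>)"
  proof (intro nn_integral_cong)
    fix x
    have "(\<lambda>(w, y). ennreal (norm (U' w y - U' x y))) \<in> borel_measurable (borel \<Otimes>\<^sub>M borel)"
      by measurable
    from nn_integral_rotation_path[OF this, of pi]
    show "(\<integral>\<^sup>+w. \<integral>\<^sup>+y. (\<integral>\<^sup>+s\<in>{0..pi}. ennreal (norm (U' (?rot s w y) (?rot' s w y) - U' x (?rot' s w y))) \<partial>lborel) \<partial>\<gamma> \<partial>\<gamma>)
      = ennreal pi * (\<integral>\<^sup>+w. \<integral>\<^sup>+y. ennreal (norm (U' w y - U' x y)) \<partial>\<gamma> \<partial>\<gamma>)" by simp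
  qed
  also have "\<dots> = ennreal pi * ?D"
    by (rule nn_integral_cmult) measurable
  also have "\<dots> \<le> ennreal pi * (ennreal (pi / 2) * ?I)"
    by (intro mult_left_mono second) simp
  also have "\<dots> = 2 * (ennreal (pi\<^sup>2 / 4) * ?I)"
  proof -
    have "ennreal pi * ennreal (pi / 2) = ennreal 2 * ennreal (pi\<^sup>2 / 4)"
      by (simp add: ennreal_mult[symmetric] power2_eq_square del: ennreal_numeral)
    then show ?thesis by (simp add: mult.assoc[symmetric])
  qed
  finally have "2 * (\<integral>\<^sup>+x. \<integral>\<^sup>+w. ennreal (norm (U' x w)) \<partial>\<gamma> \<partial>\<gamma>) \<le>
      2 * ((\<integral>\<^sup>+w. ennreal (norm (U w)) \<partial>\<gamma>) + ennreal (pi\<^sup>2 / 4) * ?I)"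
    by (simp add: add_left_mono distrib_left mult_2)
  then show ?thesis
    by (subst (asm) ennreal_mult_le_mult_iff) simp_all
qed

end

section \<open>Moments of Gaussian vectors in an inner product space\<close>

lemma finite_orthonormal_expansion:
  fixes X :: "'k::real_inner set"
  assumes "finite X"
  shows "\<exists>E. finite E \<and> orthonormal_set E \<and> (\<forall>x\<in>X. x = (\<Sum>e\<in>E. (x \<bullet> e) *\<^sub>R e))"
proof -
  obtain xs where xs: "set xs = X" using finite_list[OF assms] by blast
  define d where "d = (\<lambda>n. if n < length xs then xs ! n else 0)"
  define E where "E = gram_schmidt d (length xs)"
  have E: "finite E" "orthonormal_set E"
    by (simp_all add: E_def finite_gram_schmidt orthonormal_gram_schmidt)
  have "linear (\<lambda>x. \<Sum>e\<in>E. (x \<bullet> e) *\<^sub>R e)"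
    by (rule linearI) (simp_all add: inner_add_left scaleR_add_left sum.distrib scaleR_sum_right)
  moreover have "b = (\<Sum>e\<in>E. (b \<bullet> e) *\<^sub>R e)" if "b \<in> E" for b
  proof -
    have "(\<Sum>e\<in>E. (b \<bullet> e) *\<^sub>R e) = (\<Sum>e\<in>E. if e = b then b else 0)"
      using E(2) that by (intro sum.cong) (auto simp: orthonormal_set_def)
    then show ?thesis using E(1) that by simp
  qed
  ultimately have span: "x = (\<Sum>e\<in>E. (x \<bullet> e) *\<^sub>R e)" if "x \<in> span E" for x
    using linear_eq_on_span[OF linear_id _ _ that] by fastforce
  have "x \<in> span E" if x: "x \<in> X" for x
  proof -
    obtain n where n: "n < length xs" "x = d n"
      using x unfolding xs[symmetric] by (auto simp: d_def in_set_conv_nth)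
    have "gram_schmidt d (Suc n) \<subseteq> E" unfolding E_def using n(1) by (intro gram_schmidt_mono) simp
    then show ?thesis using gram_schmidt_span[of d n] span_mono n(2) by blast
  qed
  then show ?thesis using E span by blast
qed

context gaussian_law
begin

lemma abs_moment_indexed:
  fixes idx :: "'a \<Rightarrow> 'i"
  assumes A: "finite A"
  shows "has_bochner_integral \<gamma> (\<lambda>x. \<bar>\<Sum>a\<in>A. c a * x (idx a)\<bar>) (sqrt (2 / pi) * norm (\<Sum>a\<in>A. c a *\<^sub>R h (idx a)))"
proof -
  define c' where "c' = (\<lambda>j. \<Sum>a | a \<in> A \<and> idx a = j. c a)"
  have "(\<Sum>a\<in>A. c a * x (idx a)) = (\<Sum>j\<in>idx ` A. c' j * x j)" for x :: "'i \<Rightarrow> real"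
    by (subst sum.image_gen[OF A, of _ idx]) (auto simp: c'_def sum_distrib_right intro!: sum.cong)
  moreover have "(\<Sum>a\<in>A. c a *\<^sub>R h (idx a)) = (\<Sum>j\<in>idx ` A. c' j *\<^sub>R h j)"
    by (subst sum.image_gen[OF A, of _ idx]) (auto simp: c'_def scaleR_sum_left intro!: sum.cong)
  ultimately show ?thesis
    using abs_moment_linear_combination[of "idx ` A" c'] A by simp
qed

lemma second_moment_vector:
  fixes T :: "'a \<Rightarrow> 'k::real_inner" and idx :: "'a \<Rightarrow> 'i"
  shows "has_bochner_integral \<gamma> (\<lambda>x. (norm (\<Sum>a\<in>A. x (idx a) *\<^sub>R T a))\<^sup>2)
    (\<Sum>a\<in>A. \<Sum>b\<in>A. (h (idx a) \<bullet> h (idx b)) * (T a \<bullet> T b))"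
proof -
  have "has_bochner_integral \<gamma> (\<lambda>x. \<Sum>a\<in>A. \<Sum>b\<in>A. (x (idx a) * x (idx b)) * (T a \<bullet> T b))
    (\<Sum>a\<in>A. \<Sum>b\<in>A. (h (idx a) \<bullet> h (idx b)) * (T a \<bullet> T b))"
    by (intro has_bochner_integral_sum has_bochner_integral_mult_left covariance)
  moreover have "(\<Sum>a\<in>A. \<Sum>b\<in>A. (x (idx a) * x (idx b)) * (T a \<bullet> T b)) = (norm (\<Sum>a\<in>A. x (idx a) *\<^sub>R T a))\<^sup>2"
    for x :: "'i \<Rightarrow> real"
    by (simp add: power2_norm_eq_inner inner_sum_left inner_sum_right sum_distrib_left mult_ac inner_commute)
  ultimately show ?thesis by simp
qed

text \<open>In an arbitrary inner product space, measurability of the norm is derived from that of its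
  square, which is a polynomial in the coordinates.\<close>

lemma norm_vector_integrable:
  fixes T :: "'a \<Rightarrow> 'k::real_inner" and idx :: "'a \<Rightarrow> 'i"
  shows "integrable \<gamma> (\<lambda>x. norm (\<Sum>a\<in>A. x (idx a) *\<^sub>R T a))"
proof (rule square_integrable_imp_integrable)
  show sq: "integrable \<gamma> (\<lambda>x. (norm (\<Sum>a\<in>A. x (idx a) *\<^sub>R T a))\<^sup>2)"
    by (rule integrable.intros[OF second_moment_vector])
  define Q where "Q = (\<lambda>x. (norm (\<Sum>a\<in>A. x (idx a) *\<^sub>R T a))\<^sup>2)"
  have "Q \<in> borel_measurable \<gamma>"
    using borel_measurable_integrable[OF sq] by (simp only: Q_def)
  then have "(\<lambda>x. sqrt (Q x)) \<in> borel_measurable \<gamma>" by measurable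
  then show "(\<lambda>x. norm (\<Sum>a\<in>A. x (idx a) *\<^sub>R T a)) \<in> borel_measurable \<gamma>"
    by (simp add: Q_def)
qed

lemma nn_integral_norm_vector_le:
  fixes T :: "'a \<Rightarrow> 'k::real_inner" and idx :: "'a \<Rightarrow> 'i"
  assumes S: "S\<^sup>2 = (\<Sum>a\<in>A. \<Sum>b\<in>A. (h (idx a) \<bullet> h (idx b)) * (T a \<bullet> T b))" "0 \<le> S"
  shows "(\<integral>\<^sup>+x. ennreal (norm (\<Sum>a\<in>A. x (idx a) *\<^sub>R T a)) \<partial>\<gamma>) \<le> ennreal S"
proof -
  define X where "X = (\<lambda>x. norm (\<Sum>a\<in>A. x (idx a) *\<^sub>R T a))"
  have sq: "has_bochner_integral \<gamma> (\<lambda>x. (X x)\<^sup>2) (S\<^sup>2)"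
    unfolding X_def S(1) by (rule second_moment_vector)
  have int: "integrable \<gamma> X"
    unfolding X_def by (rule norm_vector_integrable)
  have "variance X = S\<^sup>2 - (expectation X)\<^sup>2"
    unfolding variance_eq[OF int integrable.intros[OF sq]] has_bochner_integral_integral_eq[OF sq] ..
  with variance_positive[of X] have "(expectation X)\<^sup>2 \<le> S\<^sup>2" by linarith
  then have "expectation X \<le> S" using S(2) by (rule power2_le_imp_le)
  moreover have "(\<integral>\<^sup>+x. ennreal (X x) \<partial>\<gamma>) = ennreal (expectation X)"
    by (rule nn_integral_eq_integral[OF int]) (simp add: X_def)
  ultimately show ?thesis by (simp add: X_def ennreal_leI)
qed

text \<open>Khinchine's inequality. In coordinates with respect to an orthonormal basis, testing the norm
  against the vector of standard deviations \<open>\<sigma>\<close> of the coordinates gives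
  \<open>S * norm X \<ge> (\<Sum>e. \<sigma> e * \<bar>X \<bullet> e\<bar>)\<close>, and \<open>\<bar>X \<bullet> e\<bar>\<close> has mean \<open>sqrt (2 / pi) * \<sigma> e\<close>.\<close>

lemma khinchine_vector:
  fixes T :: "'a \<Rightarrow> 'k::real_inner" and idx :: "'a \<Rightarrow> 'i"
  assumes A: "finite A"
    and S: "S\<^sup>2 = (\<Sum>a\<in>A. \<Sum>b\<in>A. (h (idx a) \<bullet> h (idx b)) * (T a \<bullet> T b))" "0 \<le> S"
  shows "ennreal S \<le> ennreal (sqrt (pi / 2)) * (\<integral>\<^sup>+x. ennreal (norm (\<Sum>a\<in>A. x (idx a) *\<^sub>R T a)) \<partial>\<gamma>)"
proof -
  let ?X = "\<lambda>x. (\<Sum>a\<in>A. x (idx a) *\<^sub>R T a)"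
  obtain E where E: "finite E" "orthonormal_set E" and T: "\<And>a. a \<in> A \<Longrightarrow> T a = (\<Sum>e\<in>E. (T a \<bullet> e) *\<^sub>R e)"
    using finite_orthonormal_expansion[of "T ` A"] A by auto
  define \<sigma> where "\<sigma> = (\<lambda>e. norm (\<Sum>a\<in>A. (T a \<bullet> e) *\<^sub>R h (idx a)))"
  have ip: "T a \<bullet> T b = (\<Sum>e\<in>E. (T a \<bullet> e) * (T b \<bullet> e))" if "a \<in> A" for a b
  proof -
    have "T a \<bullet> T b = (\<Sum>e\<in>E. (T a \<bullet> e) *\<^sub>R e) \<bullet> T b" using T[OF that] by (rule arg_cong)
    then have "T a \<bullet> T b = (\<Sum>e\<in>E. (T a \<bullet> e) * (e \<bullet> T b))"
      by (simp only: inner_sum_left inner_scaleR_left)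
    then show ?thesis by (simp only: inner_commute[of "T b"])
  qed
  have S_\<sigma>: "S\<^sup>2 = (\<Sum>e\<in>E. (\<sigma> e)\<^sup>2)"
  proof -
    have "(\<Sum>e\<in>E. (\<sigma> e)\<^sup>2) = (\<Sum>e\<in>E. \<Sum>a\<in>A. \<Sum>b\<in>A. (h (idx a) \<bullet> h (idx b)) * ((T a \<bullet> e) * (T b \<bullet> e)))"
      by (simp add: \<sigma>_def power2_norm_eq_inner inner_sum_left inner_sum_right sum_distrib_left mult_ac inner_commute)
    also have "\<dots> = (\<Sum>a\<in>A. \<Sum>e\<in>E. \<Sum>b\<in>A. (h (idx a) \<bullet> h (idx b)) * ((T a \<bullet> e) * (T b \<bullet> e)))"
      by (rule sum.swap)
    also have "\<dots> = (\<Sum>a\<in>A. \<Sum>b\<in>A. \<Sum>e\<in>E. (h (idx a) \<bullet> h (idx b)) * ((T a \<bullet> e) * (T b \<bullet> e)))"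
      by (intro sum.cong refl sum.swap)
    also have "\<dots> = S\<^sup>2"
      unfolding S(1) by (intro sum.cong refl) (simp add: ip sum_distrib_left)
    finally show ?thesis by simp
  qed
  have point: "(\<Sum>e\<in>E. \<sigma> e * \<bar>\<Sum>a\<in>A. (T a \<bullet> e) * x (idx a)\<bar>) \<le> S * norm (?X x)" for x
  proof -
    \<comment> \<open>The vector of standard deviations, with signs aligned to \<open>X\<close>; its norm is at most \<open>S\<close>.\<close>
    define w where "w = (\<Sum>e\<in>E. (\<sigma> e * sgn (?X x \<bullet> e)) *\<^sub>R e)"
    have "w \<bullet> e = \<sigma> e * sgn (?X x \<bullet> e)" if "e \<in> E" for e
      unfolding w_def by (rule inner_sum_orthonormal[OF E(2,1) order_refl that])
    then have "w \<bullet> w = (\<Sum>e\<in>E. (\<sigma> e * sgn (?X x \<bullet> e))\<^sup>2)"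
      by (subst (2) w_def) (simp add: inner_sum_right power2_eq_square)
    also have "\<dots> \<le> (\<Sum>e\<in>E. (\<sigma> e)\<^sup>2)"
      by (intro sum_mono) (auto simp: sgn_real_def)
    finally have "(norm w)\<^sup>2 \<le> S\<^sup>2" unfolding S_\<sigma> by (simp add: power2_norm_eq_inner)
    then have w: "norm w \<le> S" by (rule power2_le_imp_le) fact
    have "(\<Sum>e\<in>E. \<sigma> e * \<bar>\<Sum>a\<in>A. (T a \<bullet> e) * x (idx a)\<bar>) = ?X x \<bullet> w"
    proof -
      have "(\<Sum>a\<in>A. (T a \<bullet> e) * x (idx a)) = ?X x \<bullet> e" for e
        by (simp add: inner_sum_left mult.commute)
      moreover have "?X x \<bullet> w = (\<Sum>e\<in>E. \<sigma> e * \<bar>?X x \<bullet> e\<bar>)"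
        unfolding w_def by (subst inner_sum_right) (auto intro!: sum.cong simp: abs_sgn mult_ac)
      ultimately show ?thesis by simp
    qed
    also have "\<dots> \<le> norm (?X x) * norm w" by (rule norm_cauchy_schwarz)
    also have "\<dots> \<le> S * norm (?X x)" using w by (simp add: mult.commute mult_right_mono)
    finally show ?thesis .
  qed
  have hb: "has_bochner_integral \<gamma> (\<lambda>x. \<Sum>e\<in>E. \<sigma> e * \<bar>\<Sum>a\<in>A. (T a \<bullet> e) * x (idx a)\<bar>)
      (\<Sum>e\<in>E. \<sigma> e * (sqrt (2 / pi) * \<sigma> e))"
    unfolding \<sigma>_def by (intro has_bochner_integral_sum has_bochner_integral_mult_right abs_moment_indexed A)
  have "sqrt (2 / pi) * S\<^sup>2 = (\<Sum>e\<in>E. \<sigma> e * (sqrt (2 / pi) * \<sigma> e))"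
    unfolding S_\<sigma> by (simp add: sum_distrib_left power2_eq_square mult_ac)
  also have "\<dots> \<le> (\<integral>x. S * norm (?X x) \<partial>\<gamma>)"
    unfolding has_bochner_integral_integral_eq[OF hb, symmetric]
    by (intro integral_mono integrable.intros[OF hb] integrable_mult_right norm_vector_integrable point)
  finally have "S * (sqrt (2 / pi) * S) \<le> S * expectation (\<lambda>x. norm (?X x))"
    by (simp add: power2_eq_square mult_ac)
  moreover have "0 \<le> expectation (\<lambda>x. norm (?X x))" by (rule integral_nonneg_AE) simp
  ultimately have "sqrt (2 / pi) * S \<le> expectation (\<lambda>x. norm (?X x))"
    using S(2) by (cases "S = 0") auto
  then have "sqrt (pi / 2) * (sqrt (2 / pi) * S) \<le> sqrt (pi / 2) * expectation (\<lambda>x. norm (?X x))"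
    by (rule mult_left_mono) simp
  moreover have "sqrt (pi / 2) * (sqrt (2 / pi) * S) = S"
    by (simp add: mult.assoc[symmetric] real_sqrt_mult[symmetric])
  ultimately have "ennreal S \<le> ennreal (sqrt (pi / 2) * expectation (\<lambda>x. norm (?X x)))"
    by (intro ennreal_leI) simp
  then show ?thesis
    by (subst nn_integral_eq_integral) (auto simp: norm_vector_integrable ennreal_mult')
qed

end

section \<open>Laws of isonormal processes\<close>

lemma centered_gaussian_law:
  assumes "prob_space M" and X: "centered_gaussian M X"
  obtains s where "s \<ge> 0" "distr M borel X = distr std_normal_distribution borel (\<lambda>t. s * t)"
proof -
  interpret prob_space M by fact
  interpret std: real_distribution std_normal_distribution by (rule real_dist_normal_dist)
  have [measurable]: "X \<in> borel_measurable M" using X by (simp add: centered_gaussian_def)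
  from X consider "AE \<omega> in M. X \<omega> = 0" | \<sigma> where "\<sigma> > 0" "distributed M lborel X (normal_density 0 \<sigma>)"
    by (auto simp: centered_gaussian_def)
  then show ?thesis
  proof cases
    case 1
    then have "distr M borel X = distr M borel (\<lambda>_. 0)" by (intro distr_cong_AE) auto
    also have "\<dots> = return borel 0" by (rule distr_const) simp
    also have "\<dots> = distr std_normal_distribution borel (\<lambda>t. 0 * t)"
      using std.distr_const[of 0 borel] by simp
    finally show ?thesis using that[of 0] by simp
  next
    case 2
    then have "distributed M lborel (\<lambda>\<omega>. X \<omega> / \<sigma>) std_normal_density"
      using normal_standard_normal_convert[of \<sigma> X 0] by simp
    then have "std_normal_distribution = distr M lborel (\<lambda>\<omega>. X \<omega> / \<sigma>)"
      by (simp add: distributed_distr_eq_density)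
    then have "distr std_normal_distribution borel (\<lambda>t. \<sigma> * t) = distr M borel X"
      using 2(1) by (simp add: distr_distr o_def)
    then show ?thesis using that[of \<sigma>] 2(1) by simp
  qed
qed

text \<open>A linear combination of the \<open>W (h i)\<close> is a multiple of a standard normal variable, and its
  second moment identifies the factor. The square-integrability needed to expand that moment comes
  from the Gaussian law of each single \<open>W g\<close>.\<close>

lemma isonormal_gaussian_law:
  fixes h :: "'i::countable \<Rightarrow> 'h::real_inner"
  assumes W: "isonormal_process M W"
  shows "gaussian_law (distr M borel (\<lambda>\<omega> i. W (h i) \<omega>)) h"
    and "(\<lambda>\<omega> i. W (h i) \<omega>) \<in> borel_measurable M"
proof -
  interpret prob_space M using W by (simp add: isonormal_process_def)
  have gauss: "centered_gaussian M (\<lambda>\<omega>. \<Sum>g\<in>A. c g * W g \<omega>)" if "finite A" for A c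
    using W that by (simp add: isonormal_process_def centered_gaussian_family_def)
  have gauss1: "centered_gaussian M (W g)" for g
    using gauss[of "{g}" "\<lambda>_. 1"] by simp
  have cov: "expectation (\<lambda>\<omega>. W g \<omega> * W g' \<omega>) = g \<bullet> g'" for g g'
    using W by (simp add: isonormal_process_def)
  have mW [measurable]: "W g \<in> borel_measurable M" for g
    using gauss1[of g] by (simp add: centered_gaussian_def)
  have sq: "integrable M (\<lambda>\<omega>. (W g \<omega>)\<^sup>2)" for g
  proof -
    obtain s where "distr M borel (W g) = distr std_normal_distribution borel (\<lambda>t. s * t)"
      using centered_gaussian_law[OF prob_space_axioms gauss1[of g]] by blast
    from integrable.intros[OF second_moment_of_law[OF mW this]] show ?thesis .
  qed
  have prod: "integrable M (\<lambda>\<omega>. W g \<omega> * W g' \<omega>)" for g g'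
  proof (rule Bochner_Integration.integrable_bound)
    show "integrable M (\<lambda>\<omega>. (W g \<omega>)\<^sup>2 + (W g' \<omega>)\<^sup>2)" by (intro Bochner_Integration.integrable_add sq)
    have "\<bar>a * b\<bar> \<le> a\<^sup>2 + b\<^sup>2" for a b :: real
      using sum_squares_bound[of "\<bar>a\<bar>" "\<bar>b\<bar>"] mult_nonneg_nonneg[of "\<bar>a\<bar>" "\<bar>b\<bar>"]
      unfolding abs_mult mult.assoc power2_abs by linarith
    then show "AE \<omega> in M. norm (W g \<omega> * W g' \<omega>) \<le> norm ((W g \<omega>)\<^sup>2 + (W g' \<omega>)\<^sup>2)" by simp
  qed simp
  show mZ [measurable]: "(\<lambda>\<omega> i. W (h i) \<omega>) \<in> borel_measurable M"
    unfolding measurable_cong_sets[OF refl sets_PiM_equal_borel[symmetric]]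
    by (rule measurable_PiM_single') auto
  have coordinate [measurable]: "(\<lambda>z :: 'i \<Rightarrow> real. z i) \<in> borel_measurable borel" for i
    by (rule borel_measurable_continuous_onI) (rule continuous_on_product_coordinates)
  show "gaussian_law (distr M borel (\<lambda>\<omega> i. W (h i) \<omega>)) h"
  proof
    fix S :: "'i set" and c assume S: "finite S"
    define X where "X = (\<lambda>\<omega>. \<Sum>i\<in>S. c i * W (h i) \<omega>)"
    define V where "V = (\<Sum>i\<in>S. c i *\<^sub>R h i)"
    have [measurable]: "X \<in> borel_measurable M" unfolding X_def by measurable
    have "X \<omega> = (\<Sum>g\<in>h ` S. (\<Sum>i | i \<in> S \<and> h i = g. c i) * W g \<omega>)" for \<omega>
      unfolding X_def by (subst sum.image_gen[OF S, of _ h]) (auto simp: sum_distrib_right intro!: sum.cong)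
    then have X_eq: "X = (\<lambda>\<omega>. \<Sum>g\<in>h ` S. (\<Sum>i | i \<in> S \<and> h i = g. c i) * W g \<omega>)" by (rule ext)
    have "centered_gaussian M X" unfolding X_eq by (rule gauss) (use S in simp)
    then obtain s where s: "s \<ge> 0" "distr M borel X = distr std_normal_distribution borel (\<lambda>t. s * t)"
      using centered_gaussian_law[OF prob_space_axioms] by blast
    have "has_bochner_integral M (\<lambda>\<omega>. \<Sum>i\<in>S. \<Sum>j\<in>S. (c i * c j) * (W (h i) \<omega> * W (h j) \<omega>))
        (\<Sum>i\<in>S. \<Sum>j\<in>S. (c i * c j) * (h i \<bullet> h j))"
      by (intro has_bochner_integral_sum has_bochner_integral_mult_right)
        (simp add: has_bochner_integral_iff prod cov)
    moreover have "(\<Sum>i\<in>S. \<Sum>j\<in>S. (c i * c j) * (W (h i) \<omega> * W (h j) \<omega>)) = (X \<omega>)\<^sup>2" for \<omega>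
      by (simp add: X_def power2_eq_square sum_product mult_ac)
    moreover have "(\<Sum>i\<in>S. \<Sum>j\<in>S. (c i * c j) * (h i \<bullet> h j)) = (norm V)\<^sup>2"
      by (simp add: V_def power2_norm_eq_inner inner_sum_left inner_sum_right sum_distrib_left mult_ac inner_commute)
    ultimately have "has_bochner_integral M (\<lambda>\<omega>. (X \<omega>)\<^sup>2) ((norm V)\<^sup>2)" by simp
    then have "s\<^sup>2 = (norm V)\<^sup>2"
      using has_bochner_integral_eq second_moment_of_law[OF \<open>X \<in> borel_measurable M\<close> s(2)] by blast
    then have sV: "s = norm V" using s(1) by simp
    have "distr (distr M borel (\<lambda>\<omega> i. W (h i) \<omega>)) borel (\<lambda>x. \<Sum>i\<in>S. c i * x i) = distr M borel X"
      by (subst distr_distr) (auto simp: o_def X_def)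
    then show "distr (distr M borel (\<lambda>\<omega> i. W (h i) \<omega>)) borel (\<lambda>x. \<Sum>i\<in>S. c i * x i) =
        distr std_normal_distribution borel (\<lambda>t. norm (\<Sum>i\<in>S. c i *\<^sub>R h i) * t)"
      using s(2) sV by (simp add: V_def)
  qed simp
qed

section \<open>Partial derivatives of smooth functions\<close>

lemma partials_Cons: "partials (i # is) f = partial i (partials is f)"
  by (simp add: partials_def)

lemma partials_cong:
  assumes f: "smooth_fun m f" and "is \<in> lists {..<m}" "\<And>i. i < m \<Longrightarrow> x i = y i"
  shows "partials is f x = partials is f y"
  using assms(2,3)
proof (induction "is" arbitrary: x y rule: list.induct)
  case Nil
  then show ?case using f by (auto simp: partials_def smooth_fun_def)
next
  case (Cons i "is")
  have "partials is f (x(i := t)) = partials is f (y(i := t))" for t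
    by (rule Cons.IH) (use Cons.prems in auto)
  moreover have "x i = y i" using Cons.prems(1) by (intro Cons.prems(2)) simp
  ultimately show ?case by (simp add: partials_Cons partial_def)
qed

lemma partials_chain_rule:
  assumes f: "smooth_fun m f" and "is \<in> lists {..<m}"
    and p: "\<And>i. i < m \<Longrightarrow> ((\<lambda>r. p r i) has_real_derivative q i) (at s)"
  shows "((\<lambda>r. partials is f (p r)) has_real_derivative (\<Sum>i<m. partials (i # is) f (p s) * q i)) (at s)"
  unfolding partials_Cons
proof (rule chain_rule_partials)
  have smooth: "continuous_on UNIV (partials js f)"
    "i < m \<Longrightarrow> (\<lambda>t. partials js f (x(i := t))) differentiable (at (x i))"
    if "js \<in> lists {..<m}" for js i x
    using f that unfolding smooth_fun_def by blast+
  show "continuous_on UNIV (partial i (partials is f))" if "i < m" for i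
    unfolding partials_Cons[symmetric] by (rule smooth(1)) (use that assms(2) in simp)
  show "(\<lambda>t. partials is f (x(i := t))) differentiable (at (x i))" if "i < m" for i x
    using smooth(2)[OF assms(2) that] .
qed (use partials_cong[OF f assms(2)] p in blast)+

lemma has_vector_derivative_scaleR_right_const:
  assumes "(c has_real_derivative d) (at s)"
  shows "((\<lambda>r. c r *\<^sub>R v) has_vector_derivative d *\<^sub>R v) (at s)"
  using has_vector_derivative_scaleR[OF assms has_vector_derivative_const[of v]] by simp

definition multi_indices :: "nat \<Rightarrow> nat \<Rightarrow> nat list set" where
  "multi_indices m k = {is. set is \<subseteq> {..<m} \<and> length is = k}"

lemma multi_indices_lists: "is \<in> multi_indices m k \<Longrightarrow> is \<in> lists {..<m}"
  by (auto simp: multi_indices_def)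

lemma finite_multi_indices [simp]: "finite (multi_indices m k)"
  unfolding multi_indices_def by (rule finite_lists_length_eq) simp

lemma multi_indices_0 [simp]: "multi_indices m 0 = {[]}"
  by (auto simp: multi_indices_def)

lemma sum_multi_indices_Suc:
  fixes g :: "nat list \<Rightarrow> 'k::comm_monoid_add"
  shows "(\<Sum>is\<in>multi_indices m (Suc k). g is) = (\<Sum>is\<in>multi_indices m k. \<Sum>i<m. g (i # is))"
proof -
  have "multi_indices m (Suc k) = (\<lambda>(is, i). i # is) ` (multi_indices m k \<times> {..<m})"
    by (auto simp: multi_indices_def length_Suc_conv image_iff)
  moreover have "inj_on (\<lambda>(is, i). i # is) (multi_indices m k \<times> {..<m})"
    by (auto simp: inj_on_def)
  ultimately have "(\<Sum>is\<in>multi_indices m (Suc k). g is) = (\<Sum>(is, i)\<in>multi_indices m k \<times> {..<m}. g (i # is))"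
    by (simp add: sum.reindex case_prod_unfold o_def)
  then show ?thesis by (simp add: sum.cartesian_product)
qed

section \<open>Tensor fields\<close>

lemma inner_pure_tensor_Cons:
  "(pure_tensor (g # gs) \<otimes>\<^sub>V v) \<bullet> (pure_tensor (g' # gs') \<otimes>\<^sub>V v') =
     (g \<bullet> g') * ((pure_tensor gs \<otimes>\<^sub>V v) \<bullet> (pure_tensor gs' \<otimes>\<^sub>V v'))"
  by (simp add: inner_tensor_vec inner_pure_tensor prod.lessThan_Suc_shift del: prod.lessThan_Suc)

text \<open>The fields \<open>D\<^sup>k F\<close> as functions of the Gaussian coordinates: row \<open>j\<close> of a point
  holds the arguments of \<open>f j\<close>. A family of coefficients \<open>C j is\<close> stands for the tensor
  \<open>tensor_sum k C\<close>; \<open>contraction k C w\<close> is the contraction of \<open>tensor_sum (Suc k) C\<close>, in the first slot, with the random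
  functional that sends \<open>h (j, i)\<close> to \<open>w (j, i)\<close>.\<close>

locale gaussian_tensor_field = gaussian_law \<gamma> h
  for \<gamma> :: "(nat \<times> nat \<Rightarrow> real) measure" and h :: "nat \<times> nat \<Rightarrow> 'h::{real_inner,second_countable_topology}" +
  fixes J :: nat and m :: "nat \<Rightarrow> nat" and f :: "nat \<Rightarrow> (nat \<Rightarrow> real) \<Rightarrow> real"
    and v :: "nat \<Rightarrow> 'v::{real_inner,second_countable_topology}"
  assumes smooth: "j < J \<Longrightarrow> smooth_fun (m j) (f j)"
begin

definition row :: "nat \<Rightarrow> (nat \<times> nat \<Rightarrow> real) \<Rightarrow> nat \<Rightarrow> real" where
  "row j x = (\<lambda>i. x (j, i))"

definition base :: "nat \<Rightarrow> nat list \<Rightarrow> ('h, 'v) htensor" where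
  "base j is = pure_tensor (map (\<lambda>i. h (j, i)) is) \<otimes>\<^sub>V v j"

definition tensor_sum :: "nat \<Rightarrow> (nat \<Rightarrow> nat list \<Rightarrow> real) \<Rightarrow> ('h, 'v) htensor" where
  "tensor_sum k C = (\<Sum>j<J. \<Sum>is\<in>multi_indices (m j) k. C j is *\<^sub>R base j is)"

definition contraction :: "nat \<Rightarrow> (nat \<Rightarrow> nat list \<Rightarrow> real) \<Rightarrow> (nat \<times> nat \<Rightarrow> real) \<Rightarrow> ('h, 'v) htensor" where
  "contraction k C w = (\<Sum>j<J. \<Sum>is\<in>multi_indices (m j) k. (\<Sum>i<m j. C j (i # is) * w (j, i)) *\<^sub>R base j is)"

definition coeff :: "(nat \<times> nat \<Rightarrow> real) \<Rightarrow> nat \<Rightarrow> nat list \<Rightarrow> real" where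
  "coeff x j is = partials is (f j) (row j x)"

definition coeff_deriv :: "(nat \<times> nat \<Rightarrow> real) \<Rightarrow> (nat \<times> nat \<Rightarrow> real) \<Rightarrow> nat \<Rightarrow> nat list \<Rightarrow> real" where
  "coeff_deriv x z j is = (\<Sum>i<m j. coeff x j (i # is) * z (j, i))"

text \<open>The Gaussian vector \<open>contraction k C\<close> has \<open>tensor_sum (Suc k) C\<close> as its tensor of
  coefficients: the mean square of its norm and the squared norm of the tensor expand into the same
  double sum, because the first slots contribute the covariances of the Gaussian coordinates. The
  mean norm of the vector is thus comparable to the norm of the tensor.\<close>

lemma norm_contraction:
  shows "(\<integral>\<^sup>+w. ennreal (norm (contraction k C w)) \<partial>\<gamma>) \<le> ennreal (norm (tensor_sum (Suc k) C))"
    and "ennreal (norm (tensor_sum (Suc k) C)) \<le> ennreal (sqrt (pi / 2)) * (\<integral>\<^sup>+w. ennreal (norm (contraction k C w)) \<partial>\<gamma>)"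
proof -
  define A where "A = (SIGMA j:{..<J}. multi_indices (m j) k \<times> {..<m j})"
  define idx :: "nat \<times> nat list \<times> nat \<Rightarrow> nat \<times> nat" where "idx = (\<lambda>(j, is, i). (j, i))"
  define T where "T = (\<lambda>(j, is, i). C j (i # is) *\<^sub>R base j is)"
  have A: "finite A" unfolding A_def by (intro finite_SigmaI) auto
  have sum_A: "sum g A = (\<Sum>j<J. \<Sum>is\<in>multi_indices (m j) k. \<Sum>i<m j. g (j, is, i))"
    for g :: "_ \<Rightarrow> ('h, 'v) htensor"
  proof -
    have "(\<Sum>j<J. \<Sum>is\<in>multi_indices (m j) k. \<Sum>i<m j. g (j, is, i)) =
        (\<Sum>j<J. \<Sum>p\<in>multi_indices (m j) k \<times> {..<m j}. g (j, p))"
      by (simp add: sum.cartesian_product case_prod_unfold)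
    also have "\<dots> = (\<Sum>(j, p)\<in>A. g (j, p))"
      unfolding A_def by (rule sum.Sigma) auto
    finally show ?thesis by simp
  qed
  have contr: "contraction k C w = (\<Sum>a\<in>A. w (idx a) *\<^sub>R T a)" for w
    unfolding sum_A contraction_def by (simp add: idx_def T_def scaleR_sum_left mult.commute)
  define T' where "T' = (\<lambda>(j, is, i). C j (i # is) *\<^sub>R base j (i # is))"
  have tens: "tensor_sum (Suc k) C = (\<Sum>a\<in>A. T' a)"
    unfolding sum_A tensor_sum_def sum_multi_indices_Suc by (simp add: T'_def)
  have inner: "T' a \<bullet> T' b = (h (idx a) \<bullet> h (idx b)) * (T a \<bullet> T b)" for a b
    by (cases a; cases b) (simp add: T'_def T_def idx_def base_def inner_pure_tensor_Cons)
  have gram: "(norm (tensor_sum (Suc k) C))\<^sup>2 = (\<Sum>a\<in>A. \<Sum>b\<in>A. (h (idx a) \<bullet> h (idx b)) * (T a \<bullet> T b))"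
    unfolding tens power2_norm_eq_inner inner_sum_left by (simp add: inner_sum_right inner)
  show "(\<integral>\<^sup>+w. ennreal (norm (contraction k C w)) \<partial>\<gamma>) \<le> ennreal (norm (tensor_sum (Suc k) C))"
    unfolding contr by (rule nn_integral_norm_vector_le[OF gram norm_ge_zero])
  show "ennreal (norm (tensor_sum (Suc k) C)) \<le> ennreal (sqrt (pi / 2)) * (\<integral>\<^sup>+w. ennreal (norm (contraction k C w)) \<partial>\<gamma>)"
    unfolding contr by (rule khinchine_vector[OF A gram norm_ge_zero])
qed

lemma continuous_on_coeff:
  assumes "j < J" "is \<in> lists {..<m j}" and g: "continuous_on S g"
  shows "continuous_on S (\<lambda>p. coeff (g p) j is)"
proof -
  have "continuous_on UNIV (partials is (f j))"
    using smooth[OF assms(1)] assms(2) by (simp add: smooth_fun_def)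
  moreover have "continuous_on S (\<lambda>p. row j (g p))"
    unfolding row_def
    by (intro continuous_on_coordinatewise_then_product continuous_on_product_then_coordinatewise[OF g])
  ultimately show ?thesis
    unfolding coeff_def by (rule continuous_on_compose2) simp
qed

lemma coeff_chain_rule:
  assumes "j < J" "is \<in> lists {..<m j}" "\<And>a. ((\<lambda>r. p r a) has_real_derivative q a) (at s)"
  shows "((\<lambda>r. coeff (p r) j is) has_real_derivative coeff_deriv (p s) q j is) (at s)"
  using partials_chain_rule[OF smooth[OF assms(1)] assms(2), of "\<lambda>r. row j (p r)" "row j q" s] assms(3)
  by (simp add: coeff_def coeff_deriv_def row_def)

text \<open>The derivative of \<open>tensor_sum k (coeff x)\<close> in direction \<open>w\<close> is a contraction of the field of
  order \<open>k + 1\<close>, and its second derivative is a twofold contraction of the field of order \<open>k + 2\<close>.\<close>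

lemma interpolation:
  "(\<integral>\<^sup>+x. ennreal (norm (tensor_sum (Suc k) (coeff x))) \<partial>\<gamma>) \<le>
    ennreal (sqrt (pi / 2)) * ((\<integral>\<^sup>+x. ennreal (norm (tensor_sum k (coeff x))) \<partial>\<gamma>)
      + ennreal (pi\<^sup>2 / 4) * (\<integral>\<^sup>+x. ennreal (norm (tensor_sum (Suc (Suc k)) (coeff x))) \<partial>\<gamma>))"
proof -
  let ?U = "\<lambda>x. tensor_sum k (coeff x)"
  let ?U' = "\<lambda>x w. contraction k (coeff x) w"
  let ?U'' = "\<lambda>x z y. contraction k (coeff_deriv x z) y"
  note lists = multi_indices_lists
  have lists_Cons: "i # is \<in> lists {..<m j}" if "is \<in> multi_indices (m j) k" "i \<in> {..<m j}" for i j "is"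
    using lists[OF that(1)] that(2) by simp
  have lists_Cons2: "i' # i # is \<in> lists {..<m j}"
    if "is \<in> multi_indices (m j) k" "i \<in> {..<m j}" "i' \<in> {..<m j}" for i i' j "is"
    using lists_Cons[OF that(1,2)] that(3) by simp
  have coord: "continuous_on UNIV (\<lambda>p. g p a)" if "continuous_on UNIV g"
    for g :: "'p::topological_space \<Rightarrow> nat \<times> nat \<Rightarrow> real" and a
    by (rule continuous_on_product_then_coordinatewise[OF that])
  have "continuous_on UNIV ?U"
    unfolding tensor_sum_def
    by (intro continuous_on_sum continuous_on_scaleR continuous_on_const continuous_on_coeff lists continuous_on_id) auto
  moreover have "continuous_on UNIV (\<lambda>p. ?U' (fst p) (snd p))"
    unfolding contraction_def
    by (intro continuous_on_sum continuous_on_scaleR continuous_on_const continuous_on_mult continuous_on_coeff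
        lists_Cons coord[of snd] continuous_on_fst continuous_on_snd continuous_on_id) auto
  moreover have "continuous_on UNIV (\<lambda>p. ?U'' (fst p) (fst (snd p)) (snd (snd p)))"
    unfolding contraction_def coeff_deriv_def
    by (intro continuous_on_sum continuous_on_scaleR continuous_on_const continuous_on_mult continuous_on_coeff
        lists_Cons2 coord[of "\<lambda>p. fst (snd p)"] coord[of "\<lambda>p. snd (snd p)"] continuous_on_fst continuous_on_snd
        continuous_on_id) auto
  moreover have "?U' x (comb a w b z) = a *\<^sub>R ?U' x w + b *\<^sub>R ?U' x z" for x a w b z
    by (simp add: contraction_def comb_def scaleR_sum_right sum.distrib[symmetric] scaleR_add_left[symmetric]
        sum_distrib_left algebra_simps)
  moreover have "((\<lambda>s. ?U (p s)) has_vector_derivative ?U' (p s) (q s)) (at s)"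
    if "\<And>i s. ((\<lambda>s. p s i) has_real_derivative q s i) (at s)" for p q s
    unfolding tensor_sum_def contraction_def coeff_deriv_def[symmetric]
    by (intro has_vector_derivative_sum has_vector_derivative_scaleR_right_const coeff_chain_rule lists that) auto
  moreover have "((\<lambda>s. ?U' (p s) y) has_vector_derivative ?U'' (p s) (q s) y) (at s)"
    if "\<And>i s. ((\<lambda>s. p s i) has_real_derivative q s i) (at s)" for p q s y
    unfolding contraction_def
    by (intro has_vector_derivative_sum has_vector_derivative_scaleR_right_const DERIV_sum DERIV_cmult_right
        coeff_chain_rule lists_Cons that) auto
  ultimately have main: "(\<integral>\<^sup>+x. \<integral>\<^sup>+w. ennreal (norm (?U' x w)) \<partial>\<gamma> \<partial>\<gamma>) \<le> (\<integral>\<^sup>+x. ennreal (norm (?U x)) \<partial>\<gamma>)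
      + ennreal (pi\<^sup>2 / 4) * (\<integral>\<^sup>+x. \<integral>\<^sup>+z. \<integral>\<^sup>+y. ennreal (norm (?U'' x z y)) \<partial>\<gamma> \<partial>\<gamma> \<partial>\<gamma>)"
    by (rule first_order_interpolation)
  have upper: "(\<integral>\<^sup>+z. \<integral>\<^sup>+y. ennreal (norm (?U'' x z y)) \<partial>\<gamma> \<partial>\<gamma>) \<le> ennreal (norm (tensor_sum (Suc (Suc k)) (coeff x)))" for x
  proof -
    have "(\<integral>\<^sup>+z. \<integral>\<^sup>+y. ennreal (norm (?U'' x z y)) \<partial>\<gamma> \<partial>\<gamma>) \<le> (\<integral>\<^sup>+z. ennreal (norm (tensor_sum (Suc k) (coeff_deriv x z))) \<partial>\<gamma>)"
      by (intro nn_integral_mono norm_contraction(1))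
    also have "\<dots> = (\<integral>\<^sup>+z. ennreal (norm (contraction (Suc k) (coeff x) z)) \<partial>\<gamma>)"
      by (simp add: tensor_sum_def contraction_def coeff_deriv_def)
    also have "\<dots> \<le> ennreal (norm (tensor_sum (Suc (Suc k)) (coeff x)))"
      by (rule norm_contraction(1))
    finally show ?thesis .
  qed
  have meas: "(\<lambda>x. \<integral>\<^sup>+w. ennreal (norm (?U' x w)) \<partial>\<gamma>) \<in> borel_measurable \<gamma>"
  proof -
    note [measurable (raw)] = borel_measurable_continuous_2[OF \<open>continuous_on UNIV (\<lambda>p. ?U' (fst p) (snd p))\<close>]
    show ?thesis by measurable
  qed
  have "(\<integral>\<^sup>+x. ennreal (norm (tensor_sum (Suc k) (coeff x))) \<partial>\<gamma>) \<le>
      (\<integral>\<^sup>+x. ennreal (sqrt (pi / 2)) * (\<integral>\<^sup>+w. ennreal (norm (?U' x w)) \<partial>\<gamma>) \<partial>\<gamma>)"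
    by (intro nn_integral_mono norm_contraction(2))
  also have "\<dots> = ennreal (sqrt (pi / 2)) * (\<integral>\<^sup>+x. \<integral>\<^sup>+w. ennreal (norm (?U' x w)) \<partial>\<gamma> \<partial>\<gamma>)"
    by (rule nn_integral_cmult[OF meas])
  also have "\<dots> \<le> ennreal (sqrt (pi / 2)) * ((\<integral>\<^sup>+x. ennreal (norm (?U x)) \<partial>\<gamma>)
      + ennreal (pi\<^sup>2 / 4) * (\<integral>\<^sup>+x. ennreal (norm (tensor_sum (Suc (Suc k)) (coeff x))) \<partial>\<gamma>))"
    by (intro mult_left_mono order_trans[OF main] add_left_mono nn_integral_mono upper) auto
  finally show ?thesis .
qed

end

section \<open>Malliavin derivatives\<close>

text \<open>All derivatives of \<open>F\<close> of positive order are computed from one representation of \<open>F\<close>; it also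
  describes \<open>F\<close> itself almost surely. Hence it suffices to find one field for all orders.\<close>

lemma malliavin_vec_as_field:
  fixes F :: "'w \<Rightarrow> 'v::{real_inner,second_countable_topology}"
    and W :: "'h::{real_inner,second_countable_topology} \<Rightarrow> 'w \<Rightarrow> real"
  assumes F: "F \<in> smooth_vec_rv M W"
  obtains h J m f and v :: "nat \<Rightarrow> 'v" where
    "\<And>j. j < J \<Longrightarrow> smooth_fun (m j) (f j)"
    "\<And>k. AE \<omega> in M. malliavin_vec M W k F \<omega> = (\<Sum>j<J. \<Sum>is\<in>multi_indices (m j) k.
       partials is (f j) (\<lambda>i. W (h (j, i)) \<omega>) *\<^sub>R (pure_tensor (map (\<lambda>i. h (j, i)) is) \<otimes>\<^sub>V v j))"
proof -
  define r where "r = (SOME r. smooth_vec_rep M W F r)"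
  have r: "smooth_vec_rep M W F r"
    unfolding r_def using F by (intro someI_ex[of "smooth_vec_rep M W F"]) (simp add: smooth_vec_rv_def)
  obtain J G v where r_eq: "r = (J, G, v)" by (cases r)
  have G: "\<And>j. j < J \<Longrightarrow> G j \<in> smooth_rv M W"
    and F_eq: "AE \<omega> in M. F \<omega> = (\<Sum>j<J. G j \<omega> *\<^sub>R v j)"
    using r by (auto simp: r_eq smooth_vec_rep_def)
  define \<rho> where "\<rho> = (\<lambda>j. SOME r. smooth_rep M W (G j) r)"
  define m where "m = (\<lambda>j. fst (\<rho> j))"
  define h where "h = (\<lambda>(j, i). fst (snd (\<rho> j)) i)"
  define f where "f = (\<lambda>j. snd (snd (\<rho> j)))"
  have \<rho>_eq: "\<rho> j = (m j, \<lambda>i. h (j, i), f j)" for j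
    by (simp add: m_def h_def f_def)
  have rep: "smooth_rep M W (G j) (\<rho> j)" if "j < J" for j
    unfolding \<rho>_def using G[OF that] by (intro someI_ex[of "smooth_rep M W (G j)"]) (simp add: smooth_rv_def)
  have mall: "malliavin M W k (G j) \<omega> =
      (\<Sum>is\<in>multi_indices (m j) k. partials is (f j) (\<lambda>i. W (h (j, i)) \<omega>) *\<^sub>R pure_tensor (map (\<lambda>i. h (j, i)) is))" for k j \<omega>
    unfolding malliavin_def \<rho>_def[symmetric, THEN fun_cong] \<rho>_eq multi_indices_def by simp
  show ?thesis
  proof (rule that)
    show "smooth_fun (m j) (f j)" if "j < J" for j
      using rep[OF that] by (simp add: \<rho>_eq smooth_rep_def smooth_polynomial_growth_def)
    interpret tv: bounded_bilinear "(\<otimes>\<^sub>V) :: ('h, real) htensor \<Rightarrow> 'v \<Rightarrow> _" by (rule bounded_bilinear_tensor_vec)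
    fix k
    show "AE \<omega> in M. malliavin_vec M W k F \<omega> = (\<Sum>j<J. \<Sum>is\<in>multi_indices (m j) k.
       partials is (f j) (\<lambda>i. W (h (j, i)) \<omega>) *\<^sub>R (pure_tensor (map (\<lambda>i. h (j, i)) is) \<otimes>\<^sub>V v j))"
    proof (cases "k = 0")
      case True
      have "AE \<omega> in M. \<forall>j\<in>{..<J}. G j \<omega> = f j (\<lambda>i. W (h (j, i)) \<omega>)"
        using rep by (intro AE_finite_allI) (auto simp: \<rho>_eq smooth_rep_def)
      with F_eq show ?thesis
      proof eventually_elim
        case (elim \<omega>)
        then have "F \<omega> = (\<Sum>j<J. f j (\<lambda>i. W (h (j, i)) \<omega>) *\<^sub>R v j)" by simp
        then show ?case
          using True by (simp add: malliavin_vec_def partials_def tv.sum_right tv.scaleR_right)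
      qed
    next
      case False
      then show ?thesis
        unfolding malliavin_vec_def r_def[symmetric] r_eq
        by (simp add: mall tv.sum_left tv.scaleR_left)
    qed
  qed
qed

theorem theorem2p2:
  fixes M :: "'w measure"
    and W :: "'h::{real_inner,polish_space} \<Rightarrow> 'w \<Rightarrow> real"
    and F :: "'w \<Rightarrow> 'v::{real_inner,polish_space}"
    and l :: nat
  assumes "isonormal_process M W"
    and "generated_sigma_field M W"
    and "l \<ge> 1"
    and "F \<in> smooth_vec_rv M W"
  shows "L1_norm M (malliavin_vec M W l F)
     \<le> ennreal (pi / 2 + 18 * sqrt (2 * exp 1)) *
       (L1_norm M (malliavin_vec M W (l - 1) F) + L1_norm M (malliavin_vec M W (l + 1) F))"
proof -
  obtain h J m f and v :: "nat \<Rightarrow> 'v" where smooth: "\<And>j. j < J \<Longrightarrow> smooth_fun (m j) (f j)"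
    and field: "\<And>k. AE \<omega> in M. malliavin_vec M W k F \<omega> = (\<Sum>j<J. \<Sum>is\<in>multi_indices (m j) k.
       partials is (f j) (\<lambda>i. W (h (j, i)) \<omega>) *\<^sub>R (pure_tensor (map (\<lambda>i. h (j, i)) is) \<otimes>\<^sub>V v j))"
    by (rule malliavin_vec_as_field[OF assms(4)]) (rule that, assumption+)
  let ?Z = "\<lambda>\<omega> i. W (h i) \<omega>"
  define \<gamma> where "\<gamma> = distr M borel ?Z"
  interpret gaussian_law \<gamma> h
    unfolding \<gamma>_def by (rule isonormal_gaussian_law(1)[OF assms(1)])
  interpret gaussian_tensor_field \<gamma> h J m f v
    by standard (rule smooth)
  have mZ: "?Z \<in> borel_measurable M" by (rule isonormal_gaussian_law(2)[OF assms(1)])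
  have cont: "continuous_on UNIV (\<lambda>x. tensor_sum k (coeff x))" for k
    unfolding tensor_sum_def
    by (intro continuous_on_sum continuous_on_scaleR continuous_on_const continuous_on_coeff
        multi_indices_lists continuous_on_id) auto
  have L1: "L1_norm M (malliavin_vec M W k F) = (\<integral>\<^sup>+x. ennreal (norm (tensor_sum k (coeff x))) \<partial>\<gamma>)" for k
  proof -
    have "(\<lambda>x. ennreal (norm (tensor_sum k (coeff x)))) \<in> borel_measurable (distr M borel ?Z)"
      using borel_measurable_continuous_onI[OF cont[of k]] unfolding measurable_distr_eq1 by measurable
    from nn_integral_distr[OF mZ this]
    have "(\<integral>\<^sup>+x. ennreal (norm (tensor_sum k (coeff x))) \<partial>\<gamma>) = (\<integral>\<^sup>+\<omega>. ennreal (norm (tensor_sum k (coeff (?Z \<omega>)))) \<partial>M)"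
      by (simp only: \<gamma>_def)
    moreover have "AE \<omega> in M. malliavin_vec M W k F \<omega> = tensor_sum k (coeff (?Z \<omega>))"
      using field[of k] by (simp add: tensor_sum_def coeff_def row_def base_def)
    ultimately show ?thesis
      unfolding L1_norm_def by (auto intro!: nn_integral_cong_AE)
  qed
  \<comment> \<open>The interpolation inequality has constants at most \<open>8\<close>.\<close>
  define \<eta> where "\<eta> = pi / 2 + 18 * sqrt (2 * exp 1)"
  have "1 \<le> sqrt (2 * exp 1)" using exp_ge_add_one_self[of 1] by simp
  then have "8 \<le> \<eta>" unfolding \<eta>_def using pi_gt_zero by linarith
  moreover have "sqrt (pi / 2) \<le> 2" by (rule real_le_lsqrt) (use pi_less_4 in auto)
  moreover have "sqrt (pi / 2) * (pi\<^sup>2 / 4) \<le> 2 * 4"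
    using \<open>sqrt (pi / 2) \<le> 2\<close> power_mono[of pi 4 2] pi_less_4 by (intro mult_mono) auto
  ultimately have const: "sqrt (pi / 2) \<le> \<eta>" "sqrt (pi / 2) * (pi\<^sup>2 / 4) \<le> \<eta>"
    by linarith+
  obtain k where l: "l = Suc k" using assms(3) by (cases l) auto
  let ?N = "\<lambda>k. \<integral>\<^sup>+x. ennreal (norm (tensor_sum k (coeff x))) \<partial>\<gamma>"
  have "?N (Suc k) \<le> ennreal (sqrt (pi / 2)) * (?N k + ennreal (pi\<^sup>2 / 4) * ?N (Suc (Suc k)))"
    by (rule interpolation)
  also have "\<dots> = ennreal (sqrt (pi / 2)) * ?N k + ennreal (sqrt (pi / 2) * (pi\<^sup>2 / 4)) * ?N (Suc (Suc k))"
    by (subst ennreal_mult) (simp_all only: distrib_left mult.assoc, auto)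
  also have "\<dots> \<le> ennreal \<eta> * ?N k + ennreal \<eta> * ?N (Suc (Suc k))"
    by (intro add_mono mult_right_mono ennreal_leI const) auto
  finally show ?thesis by (simp add: L1 l distrib_left \<eta>_def)
qed

end
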